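(* Let $\Gamma$ be a finite, simplicial, triangle free graph with vertex set $S$, let $G_\Gamma$ be the associated right-angled Coxeter group, and let $K$ be the subgroup of $G_\Gamma$ generated by some subset $S_1$ of $S$. Then the following conditions are equivalent: (1) The subgroup $K$ is stable in $G_\Gamma$. (2) The set $S_1$ does not contain a pair of non-adjacent vertices of an induced 4-cycle in $\Gamma$.
   Context: The right-angled Coxeter group $G_\Gamma$ has generating set $S$ the vertices of $\Gamma$ and relations $s^2=1$ for all $s\in S$ and $st=ts$ whenever $s,t$ are adjacent. A $(K,L)$-quasi-isometric embedding $\Phi$ satisfies $\frac1Kd(x,y)-L\le d(\Phi(x),\Phi(y))\le Kd(x,y)+L$; a $(K,L)$-quasi-geodesic is such an embedding of an interval of $\mathbb{R}$. A subgroup $H$ of a finitely generated group $G$ is stable in $G$ if it is finitely generated, undistorted (inclusion induces a quasi-isometric embedding of Cayley graphs), and for all $K\ge1$, $L\ge0$ there is $R=R(K,L)\ge0$ such that any two $(K,L)$-quasi-geodesics in the Cayley graph of $G$ (finite generating set) with the same endpoints in $H$ are at Hausdorff distance less than $R$. *)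

theory Defs
  imports
    Complex_Main
    "HOL-Library.Extended_Real"
    "HOL-Library.FuncSet"
    "HOL-Algebra.Generated_Groups"
    "Graph_Theory.Pair_Digraph"
begin

section \<open>Groups given by generators and relations\<close>

text \<open>The letter \<open>(s, True)\<close> stands for the generator \<open>s\<close> and \<open>(s, False)\<close> for its formal inverse.
  A pair \<open>(u, v)\<close> of words in a set of relations is the relation \<open>u = v\<close>.\<close>

type_synonym 's word = "('s \<times> bool) list"

definition words :: "'s set \<Rightarrow> 's word set" where
  "words S = lists (S \<times> UNIV)"

inductive_set word_rel :: "'s set \<Rightarrow> ('s word \<times> 's word) set \<Rightarrow> ('s word \<times> 's word) set"
  for S :: "'s set" and R :: "('s word \<times> 's word) set" where
  word_refl: "w \<in> words S \<Longrightarrow> (w, w) \<in> word_rel S R"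
| word_sym: "(u, v) \<in> word_rel S R \<Longrightarrow> (v, u) \<in> word_rel S R"
| word_trans: "(u, v) \<in> word_rel S R \<Longrightarrow> (v, w) \<in> word_rel S R \<Longrightarrow> (u, w) \<in> word_rel S R"
| word_compat: "(u, v) \<in> word_rel S R \<Longrightarrow> x \<in> words S \<Longrightarrow> y \<in> words S \<Longrightarrow>
    (x @ u @ y, x @ v @ y) \<in> word_rel S R"
| word_cancel: "s \<in> S \<Longrightarrow> ([(s, b), (s, \<not> b)], []) \<in> word_rel S R"
| word_relation: "(u, v) \<in> R \<Longrightarrow> u \<in> words S \<Longrightarrow> v \<in> words S \<Longrightarrow> (u, v) \<in> word_rel S R"

definition presented_group :: "'s set \<Rightarrow> ('s word \<times> 's word) set \<Rightarrow> 's word set monoid" where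
  "presented_group S R =
     \<lparr>carrier = words S // word_rel S R,
      monoid.mult = (\<lambda>X Y. \<Union>u\<in>X. \<Union>v\<in>Y. word_rel S R `` {u @ v}),
      one = word_rel S R `` {[]}\<rparr>"

definition presented_gen :: "'s set \<Rightarrow> ('s word \<times> 's word) set \<Rightarrow> 's \<Rightarrow> 's word set" where
  "presented_gen S R s = word_rel S R `` {[(s, True)]}"

lemma words_simps [simp]:
  "[] \<in> words S"
  "u @ v \<in> words S \<longleftrightarrow> u \<in> words S \<and> v \<in> words S"
  "(l # u) \<in> words S \<longleftrightarrow> fst l \<in> S \<and> u \<in> words S"
  by (auto simp: words_def mem_Times_iff)

lemma word_rel_words: "(u, v) \<in> word_rel S R \<Longrightarrow> u \<in> words S \<and> v \<in> words S"
  by (induction rule: word_rel.induct) auto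

lemma equiv_word_rel: "equiv (words S) (word_rel S R)"
proof (rule equivI)
  show "word_rel S R \<subseteq> words S \<times> words S"
    using word_rel_words by fastforce
  show "refl_on (words S) (word_rel S R)"
    by (auto simp: refl_on_def intro: word_rel.word_refl)
  show "sym (word_rel S R)" by (auto intro: symI word_rel.word_sym)
  show "trans (word_rel S R)" by (auto intro: transI word_rel.word_trans)
qed

lemma word_rel_append:
  assumes "(u, u') \<in> word_rel S R" "(v, v') \<in> word_rel S R"
  shows "(u @ v, u' @ v') \<in> word_rel S R"
proof -
  have "(u @ v, u' @ v) \<in> word_rel S R"
    using word_rel.word_compat[OF assms(1), of "[]" v] word_rel_words[OF assms(2)] by simp
  moreover have "(u' @ v, u' @ v') \<in> word_rel S R"
    using word_rel.word_compat[OF assms(2), of u' "[]"] word_rel_words[OF assms(1)] by simp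
  ultimately show ?thesis by (rule word_rel.word_trans)
qed

lemma word_rel_inverse:
  assumes "w \<in> words S"
  shows "(map (\<lambda>(s, b). (s, \<not> b)) (rev w) @ w, []) \<in> word_rel S R"
  using assms
proof (induction w)
  case Nil
  show ?case by (simp add: word_rel.word_refl)
next
  case (Cons l w)
  obtain s b where l: "l = (s, b)" by (cases l)
  let ?i = "map (\<lambda>(s, b). (s, \<not> b)) (rev w)"
  have w: "w \<in> words S" "s \<in> S" using Cons.prems l by auto
  have i: "?i \<in> words S" using w(1) by (auto simp: words_def)
  have "(?i @ [(s, \<not> b), (s, \<not> \<not> b)] @ w, ?i @ [] @ w) \<in> word_rel S R"
    by (intro word_rel.word_compat word_rel.word_cancel w i)
  with Cons.IH[OF w(1)] show ?case by (auto simp: l intro: word_rel.word_trans)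
qed

lemma presented_group_mult_class:
  assumes "u \<in> words S" "v \<in> words S"
  shows "(word_rel S R `` {u}) \<otimes>\<^bsub>presented_group S R\<^esub> (word_rel S R `` {v})
    = word_rel S R `` {u @ v}"
proof -
  have *: "word_rel S R `` {x @ y} = word_rel S R `` {u @ v}"
    if "x \<in> word_rel S R `` {u}" "y \<in> word_rel S R `` {v}" for x y
    using equiv_class_eq[OF equiv_word_rel word_rel_append] that by (metis Image_singleton_iff)
  have ne: "word_rel S R `` {u} \<noteq> {}" "word_rel S R `` {v} \<noteq> {}"
    using assms word_rel.word_refl by fast+
  have "(\<Union>x\<in>word_rel S R `` {u}. \<Union>y\<in>word_rel S R `` {v}. word_rel S R `` {x @ y})
      = (\<Union>x\<in>word_rel S R `` {u}. \<Union>y\<in>word_rel S R `` {v}. word_rel S R `` {u @ v})"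
    by (intro SUP_cong refl *)
  also have "\<dots> = word_rel S R `` {u @ v}"
    by (simp only: UN_constant ne if_False)
  finally show ?thesis
    by (simp only: presented_group_def monoid.simps)
qed

lemma presented_group_group: "group (presented_group S R)"
proof (rule groupI)
  let ?G = "presented_group S R"
  have carrierE: "\<exists>w \<in> words S. X = word_rel S R `` {w}" if "X \<in> carrier ?G" for X
    using that by (auto simp: presented_group_def quotient_def)
  have carrierI: "word_rel S R `` {w} \<in> carrier ?G" if "w \<in> words S" for w
    using that by (auto simp: presented_group_def quotient_def)
  have one: "\<one>\<^bsub>?G\<^esub> = word_rel S R `` {[]}" by (simp add: presented_group_def)
  show "\<one>\<^bsub>?G\<^esub> \<in> carrier ?G" unfolding one by (rule carrierI) simp
  fix X assume "X \<in> carrier ?G"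
  then obtain u where u: "u \<in> words S" "X = word_rel S R `` {u}" using carrierE by blast
  show "\<one>\<^bsub>?G\<^esub> \<otimes>\<^bsub>?G\<^esub> X = X"
    using u by (simp add: one presented_group_mult_class)
  let ?i = "map (\<lambda>(s, b). (s, \<not> b)) (rev u)"
  have i: "?i \<in> words S" using u by (auto simp: words_def)
  show "\<exists>Y\<in>carrier ?G. Y \<otimes>\<^bsub>?G\<^esub> X = \<one>\<^bsub>?G\<^esub>"
  proof
    show "word_rel S R `` {?i} \<in> carrier ?G" by (rule carrierI[OF i])
    show "(word_rel S R `` {?i}) \<otimes>\<^bsub>?G\<^esub> X = \<one>\<^bsub>?G\<^esub>"
      unfolding one u(2) presented_group_mult_class[OF i u(1)]
      by (rule equiv_class_eq[OF equiv_word_rel word_rel_inverse[OF u(1)]])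
  qed
  fix Y assume "Y \<in> carrier ?G"
  then obtain v where v: "v \<in> words S" "Y = word_rel S R `` {v}" using carrierE by blast
  show "X \<otimes>\<^bsub>?G\<^esub> Y \<in> carrier ?G"
    using u v by (simp add: presented_group_mult_class carrierI)
  fix Z assume "Z \<in> carrier ?G"
  then obtain w where w: "w \<in> words S" "Z = word_rel S R `` {w}" using carrierE by blast
  show "X \<otimes>\<^bsub>?G\<^esub> Y \<otimes>\<^bsub>?G\<^esub> Z = X \<otimes>\<^bsub>?G\<^esub> (Y \<otimes>\<^bsub>?G\<^esub> Z)"
    using u v w by (simp add: presented_group_mult_class)
qed

section \<open>Right-angled Coxeter groups\<close>

text \<open>Finite simplicial graphs are represented by \<^locale>\<open>pair_graph\<close> (finite, symmetric, loop-free,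
  no parallel arcs): vertices \<open>u\<close> and \<open>v\<close> are adjacent iff \<open>(u, v)\<close> is an arc.\<close>

definition racg_relations :: "'a pair_pre_digraph \<Rightarrow> ('a word \<times> 'a word) set" where
  "racg_relations \<Gamma> =
     {([(s, True), (s, True)], []) | s. s \<in> pverts \<Gamma>} \<union>
     {([(s, True), (t, True)], [(t, True), (s, True)]) | s t. (s, t) \<in> parcs \<Gamma>}"

definition racg :: "'a pair_pre_digraph \<Rightarrow> 'a word set monoid" where
  "racg \<Gamma> = presented_group (pverts \<Gamma>) (racg_relations \<Gamma>)"

definition racg_gen :: "'a pair_pre_digraph \<Rightarrow> 'a \<Rightarrow> 'a word set" where
  "racg_gen \<Gamma> = presented_gen (pverts \<Gamma>) (racg_relations \<Gamma>)"

definition triangle_free :: "'a pair_pre_digraph \<Rightarrow> bool" where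
  "triangle_free \<Gamma> \<longleftrightarrow>
     \<not> (\<exists>a b c. (a, b) \<in> parcs \<Gamma> \<and> (b, c) \<in> parcs \<Gamma> \<and> (c, a) \<in> parcs \<Gamma>)"

definition induced_four_cycle :: "'a pair_pre_digraph \<Rightarrow> 'a \<Rightarrow> 'a \<Rightarrow> 'a \<Rightarrow> 'a \<Rightarrow> bool" where
  "induced_four_cycle \<Gamma> a b c d \<longleftrightarrow>
     {a, b, c, d} \<subseteq> pverts \<Gamma> \<and> distinct [a, b, c, d] \<and>
     (a, b) \<in> parcs \<Gamma> \<and> (b, c) \<in> parcs \<Gamma> \<and> (c, d) \<in> parcs \<Gamma> \<and> (d, a) \<in> parcs \<Gamma> \<and>
     (a, c) \<notin> parcs \<Gamma> \<and> (b, d) \<notin> parcs \<Gamma>"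

section \<open>The Cayley graph as a metric graph\<close>

definition finite_generating_set :: "('g, 'm) monoid_scheme \<Rightarrow> 'g set \<Rightarrow> bool" where
  "finite_generating_set G A \<longleftrightarrow> finite A \<and> A \<subseteq> carrier G \<and> generate G A = carrier G"

definition cayley_adj :: "('g, 'm) monoid_scheme \<Rightarrow> 'g set \<Rightarrow> 'g \<Rightarrow> 'g \<Rightarrow> bool" where
  "cayley_adj G A g h \<longleftrightarrow>
     g \<in> carrier G \<and> h \<in> carrier G \<and> g \<noteq> h \<and> (\<exists>a\<in>A. h = g \<otimes>\<^bsub>G\<^esub> a \<or> g = h \<otimes>\<^bsub>G\<^esub> a)"

text \<open>Points of the geometric realisation are given by their barycentric coordinates, and each edge
  is isometric to the unit interval. The distance of two points is the infimum of the lengths of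
  the piecewise linear paths that join them.\<close>

definition cayley_vertex :: "'g \<Rightarrow> ('g \<Rightarrow> real)" where
  "cayley_vertex g = (\<lambda>v. of_bool (v = g))"

definition cayley_edge_point :: "'g \<Rightarrow> 'g \<Rightarrow> real \<Rightarrow> ('g \<Rightarrow> real)" where
  "cayley_edge_point g h t = (\<lambda>v. (1 - t) * cayley_vertex g v + t * cayley_vertex h v)"

definition cayley_points :: "('g, 'm) monoid_scheme \<Rightarrow> 'g set \<Rightarrow> ('g \<Rightarrow> real) set" where
  "cayley_points G A =
     cayley_vertex ` carrier G \<union>
     {cayley_edge_point g h t | g h t. cayley_adj G A g h \<and> t \<in> {0..1}}"

inductive cayley_path ::
    "('g, 'm) monoid_scheme \<Rightarrow> 'g set \<Rightarrow> ('g \<Rightarrow> real) \<Rightarrow> real \<Rightarrow> ('g \<Rightarrow> real) \<Rightarrow> bool"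
  for G :: "('g, 'm) monoid_scheme" and A :: "'g set" and x :: "'g \<Rightarrow> real" where
  path_start: "x \<in> cayley_points G A \<Longrightarrow> cayley_path G A x 0 x"
| path_segment: "cayley_path G A x l (cayley_edge_point g h s) \<Longrightarrow> cayley_adj G A g h \<Longrightarrow>
    s \<in> {0..1} \<Longrightarrow> t \<in> {0..1} \<Longrightarrow>
    cayley_path G A x (l + \<bar>s - t\<bar>) (cayley_edge_point g h t)"

definition cayley_dist ::
    "('g, 'm) monoid_scheme \<Rightarrow> 'g set \<Rightarrow> ('g \<Rightarrow> real) \<Rightarrow> ('g \<Rightarrow> real) \<Rightarrow> real" where
  "cayley_dist G A x y = Inf {l. cayley_path G A x l y}"

section \<open>Quasi-isometric embeddings and stable subgroups\<close>

definition qi_embedding ::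
    "real \<Rightarrow> real \<Rightarrow> 'x set \<Rightarrow> ('x \<Rightarrow> 'x \<Rightarrow> real) \<Rightarrow> 'y set \<Rightarrow> ('y \<Rightarrow> 'y \<Rightarrow> real) \<Rightarrow> ('x \<Rightarrow> 'y) \<Rightarrow> bool"
  where
  "qi_embedding K L X dX Y dY f \<longleftrightarrow>
     f \<in> X \<rightarrow> Y \<and>
     (\<forall>x\<in>X. \<forall>y\<in>X. 1 / K * dX x y - L \<le> dY (f x) (f y) \<and> dY (f x) (f y) \<le> K * dX x y + L)"

definition quasi_geodesic ::
    "real \<Rightarrow> real \<Rightarrow> 'y set \<Rightarrow> ('y \<Rightarrow> 'y \<Rightarrow> real) \<Rightarrow> real \<Rightarrow> real \<Rightarrow> (real \<Rightarrow> 'y) \<Rightarrow> bool" where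
  "quasi_geodesic K L Y dY a b f \<longleftrightarrow> a \<le> b \<and> qi_embedding K L {a..b} dist Y dY f"

definition hausdorff_dist :: "('y \<Rightarrow> 'y \<Rightarrow> real) \<Rightarrow> 'y set \<Rightarrow> 'y set \<Rightarrow> ereal" where
  "hausdorff_dist d P Q =
     Inf {ereal e | e. 0 \<le> e \<and> (\<forall>p\<in>P. \<exists>q\<in>Q. d p q \<le> e) \<and> (\<forall>q\<in>Q. \<exists>p\<in>P. d p q \<le> e)}"

text \<open>The inclusion is defined on vertices; inducing a quasi-isometric embedding of the Cayley graphs
  means that it extends to one.\<close>

definition undistorted :: "('g, 'm) monoid_scheme \<Rightarrow> 'g set \<Rightarrow> 'g set \<Rightarrow> 'g set \<Rightarrow> bool" where
  "undistorted G A H B \<longleftrightarrow>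
     (\<exists>K\<ge>1. \<exists>L\<ge>0. \<exists>f.
        qi_embedding K L (cayley_points (G\<lparr>carrier := H\<rparr>) B) (cayley_dist (G\<lparr>carrier := H\<rparr>) B)
          (cayley_points G A) (cayley_dist G A) f \<and>
        (\<forall>h\<in>H. f (cayley_vertex h) = cayley_vertex h))"

text \<open>The choice of the finite generating sets \<open>A\<close> of \<open>G\<close> and \<open>B\<close> of \<open>H\<close> is immaterial.\<close>

definition stable_subgroup :: "('g, 'm) monoid_scheme \<Rightarrow> 'g set \<Rightarrow> bool" where
  "stable_subgroup G H \<longleftrightarrow>
     subgroup H G \<and>
     (\<exists>A B. finite_generating_set G A \<and> finite_generating_set (G\<lparr>carrier := H\<rparr>) B \<and>
        undistorted G A H B \<and>
        (\<forall>K\<ge>1. \<forall>L\<ge>0. \<exists>R\<ge>0. \<forall>a b f a' b' f'.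
           quasi_geodesic K L (cayley_points G A) (cayley_dist G A) a b f \<and>
           quasi_geodesic K L (cayley_points G A) (cayley_dist G A) a' b' f' \<and>
           f a = f' a' \<and> f b = f' b' \<and> {f a, f b} \<subseteq> cayley_vertex ` H \<longrightarrow>
           hausdorff_dist (cayley_dist G A) (f ` {a..b}) (f' ` {a'..b'}) < ereal R))"

end

theory Submission
  imports Defs
begin

text \<open>An element \<open>g\<close> of a right-angled Coxeter group is determined by the finite set \<open>walls g\<close> of
  reflections that separate \<open>1\<close> from \<open>g\<close>. Word distance is the size of the symmetric difference of
  two such sets, and the intersection of two such sets is again one (\<open>ex_meet\<close>); all of the
  geometry below is counting of walls. Throughout, \<open>K\<close> is the subgroup generated by \<open>S\<^sub>1\<close>.

  Let \<open>s\<close> and \<open>t\<close> be non-adjacent generators, \<open>x\<close> an element behind the wall of \<open>s\<close> and \<open>y\<close> one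
  behind the wall of \<open>t\<close>. A wall separating \<open>1\<close> from both \<open>x\<close> and \<open>y\<close> crosses both of these walls,
  and it can only be the wall of a common neighbour of \<open>s\<close> and \<open>t\<close>. If \<open>s\<close> and \<open>t\<close> lie in \<open>S\<^sub>1\<close> and
  do not lie on a common induced four-cycle, then triangle-freeness leaves at most one common
  neighbour, so the distance from \<open>x\<close> to \<open>y\<close> falls short of a detour through \<open>1\<close> by at most \<open>2\<close>
  (\<open>card_common_walls\<close>). Three consecutive letters of a reduced word in a triangle-free graph
  always provide such a pair \<open>s\<close>, \<open>t\<close>, so geodesics in \<open>K\<close> meet a bottleneck of the whole group
  every three steps (\<open>ex_bottleneck\<close>).

  Fix \<open>g\<close> in \<open>K\<close> and project every \<open>x\<close> to the interval between \<open>1\<close> and \<open>g\<close>, by intersecting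
  \<open>walls x\<close> with \<open>walls g\<close>. If the projections of \<open>x\<close> and \<open>y\<close> are more than \<open>2\<close> apart, the
  distance of \<open>x\<close> and \<open>y\<close> is, up to an error of \<open>2\<close>, at least the sum of their distances to the
  interval (\<open>contraction\<close>); hence a quasi-geodesic with ends \<open>1\<close> and \<open>g\<close> cannot afford to stay far from the interval
  (\<open>excursion_bound\<close>). The interval itself is thin: points at equal distance from \<open>1\<close> are at most
  \<open>4\<close> apart (\<open>interval_thin\<close>). Two quasi-geodesics therefore come close at every height
  (\<open>fellow_travel\<close>). This carries over to the metric Cayley graph by rounding to vertices, and \<open>K\<close>
  is undistorted because reduced words of its elements use only letters of \<open>S\<^sub>1\<close>.

  Conversely, if \<open>s\<close> and \<open>t\<close> in \<open>S\<^sub>1\<close> are opposite vertices of an induced four-cycle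
  \<open>s, u, t, w\<close>, the dihedral groups of \<open>s, t\<close> and \<open>u, w\<close> commute and span a flat. The element
  \<open>stst...\<close> of length \<open>n\<close> is joined to \<open>1\<close> by the obvious path and by the one that first moves \<open>n\<close>
  steps away in the \<open>u, w\<close> direction and finally comes back. Both are quasi-geodesics with
  constants that do not depend on \<open>n\<close>, for every finite generating set: actions of the group on
  the integer line bound distances from below (\<open>line_position_step\<close>). They are not uniformly
  close (\<open>not_stable_special\<close>).\<close>

section \<open>The metric on a Cayley graph\<close>

lemma cayley_edge_point_ends [simp]:
  "cayley_edge_point g h 0 = cayley_vertex g" "cayley_edge_point g h 1 = cayley_vertex h"
  by (simp_all add: cayley_edge_point_def cayley_vertex_def fun_eq_iff)

lemma cayley_vertex_inj [simp]: "cayley_vertex g = cayley_vertex h \<longleftrightarrow> g = h"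
  by (auto simp: cayley_vertex_def fun_eq_iff of_bool_def split: if_splits)

lemma cayley_path_nonneg: "cayley_path G A x l y \<Longrightarrow> 0 \<le> l"
  by (induction rule: cayley_path.induct) auto

lemma cayley_path_segment:
  assumes "cayley_adj G A g h" "s \<in> {0..1}" "t \<in> {0..1}"
  shows "cayley_path G A (cayley_edge_point g h s) \<bar>s - t\<bar> (cayley_edge_point g h t)"
proof -
  have "cayley_path G A (cayley_edge_point g h s) 0 (cayley_edge_point g h s)"
    using assms by (intro path_start) (auto simp: cayley_points_def)
  from path_segment[OF this assms] show ?thesis by simp
qed

lemma cayley_path_trans:
  assumes "cayley_path G A y m z" "cayley_path G A x l y"
  shows "cayley_path G A x (l + m) z"
  using assms
proof (induction rule: cayley_path.induct)
  case (path_segment m g h s t)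
  then show ?case using cayley_path.path_segment[of G A x "l + m" g h s t] by (simp add: add.assoc)
qed simp

lemma cayley_path_sym: "cayley_path G A x l y \<Longrightarrow> cayley_path G A y l x"
proof (induction rule: cayley_path.induct)
  case path_start
  then show ?case by (rule cayley_path.path_start)
next
  case (path_segment l g h s t)
  have "cayley_path G A (cayley_edge_point g h t) \<bar>t - s\<bar> (cayley_edge_point g h s)"
    using path_segment by (intro cayley_path_segment) auto
  from cayley_path_trans[OF path_segment.IH this] show ?case by (simp add: add.commute abs_minus_commute)
qed

lemma cayley_path_edge: "cayley_adj G A g h \<Longrightarrow> cayley_path G A (cayley_vertex g) 1 (cayley_vertex h)"
  using cayley_path_segment[of G A g h 0 1] by simp

lemma cayley_path_vertex: "g \<in> carrier G \<Longrightarrow> cayley_path G A (cayley_vertex g) 0 (cayley_vertex g)"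
  by (intro path_start) (auto simp: cayley_points_def)

lemma near_vertex:
  assumes "x \<in> cayley_points G A"
  obtains g l where "g \<in> carrier G" "l \<le> 1" "cayley_path G A x l (cayley_vertex g)"
proof -
  consider g where "g \<in> carrier G" "x = cayley_vertex g"
    | g h t where "cayley_adj G A g h" "t \<in> {0..1}" "x = cayley_edge_point g h t"
    using assms by (auto simp: cayley_points_def)
  then show thesis
  proof cases
    case 1
    then show thesis using that[of g 0] cayley_path_vertex[of g G A] by simp
  next
    case 2
    then show thesis
      using that[of g t] cayley_path_segment[of G A g h t 0] by (auto simp: cayley_adj_def)
  qed
qed

definition affine_extension :: "('g \<Rightarrow> real) \<Rightarrow> ('g \<Rightarrow> real) \<Rightarrow> real" where
  "affine_extension F x = (\<Sum>v | x v \<noteq> 0. x v * F v)"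

lemma affine_extension_edge:
  assumes "g \<noteq> h"
  shows "affine_extension F (cayley_edge_point g h t) = (1 - t) * F g + t * F h"
proof -
  have "affine_extension F (cayley_edge_point g h t) = (\<Sum>v\<in>{g, h}. cayley_edge_point g h t v * F v)"
    unfolding affine_extension_def
    by (rule sum.mono_neutral_left)
      (auto simp: cayley_edge_point_def cayley_vertex_def of_bool_def split: if_splits)
  then show ?thesis using assms by (simp add: cayley_edge_point_def cayley_vertex_def)
qed

lemma affine_extension_vertex [simp]: "affine_extension F (cayley_vertex g) = F g"
proof -
  have "{v. cayley_vertex g v \<noteq> 0} = {g}" by (auto simp: cayley_vertex_def)
  then show ?thesis by (simp add: affine_extension_def cayley_vertex_def)
qed

text \<open>Distances in a metric Cayley graph are infima over paths, so they are bounded from below by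
  Lipschitz functions; it suffices to bound the jump along one edge.\<close>

lemma affine_extension_lipschitz:
  assumes "cayley_path G A x l y"
    and F: "\<And>g h. cayley_adj G A g h \<Longrightarrow> \<bar>F g - F h\<bar> \<le> M"
  shows "\<bar>affine_extension F x - affine_extension F y\<bar> \<le> M * l"
  using assms(1)
proof (induction rule: cayley_path.induct)
  case (path_segment l g h s t)
  have "g \<noteq> h" using path_segment by (simp add: cayley_adj_def)
  then have "affine_extension F (cayley_edge_point g h s) - affine_extension F (cayley_edge_point g h t)
      = (s - t) * (F h - F g)"
    by (simp add: affine_extension_edge algebra_simps)
  moreover have "\<bar>F h - F g\<bar> \<le> M" using F[OF path_segment(2)] by (simp add: abs_minus_commute)
  ultimately have "\<bar>affine_extension F (cayley_edge_point g h s) - affine_extension F (cayley_edge_point g h t)\<bar>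
      \<le> M * \<bar>s - t\<bar>"
    using mult_left_mono[of "\<bar>F h - F g\<bar>" M "\<bar>s - t\<bar>"] by (simp add: abs_mult mult.commute)
  with path_segment.IH show ?case by (simp add: algebra_simps)
qed simp

lemma cayley_dist_le: "cayley_path G A x l y \<Longrightarrow> cayley_dist G A x y \<le> l"
  unfolding cayley_dist_def by (rule cInf_lower) (auto intro!: bdd_belowI[of _ 0] cayley_path_nonneg)

lemma cayley_dist_ge:
  assumes "cayley_path G A x l y" "\<And>l. cayley_path G A x l y \<Longrightarrow> c \<le> l"
  shows "c \<le> cayley_dist G A x y"
  unfolding cayley_dist_def using assms by (intro cInf_greatest) auto

lemma cayley_dist_sym: "cayley_dist G A x y = cayley_dist G A y x"
  unfolding cayley_dist_def using cayley_path_sym by metis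

lemma cayley_dist_lipschitz:
  assumes "cayley_path G A x l y" "M > 0"
    and F: "\<And>g h. cayley_adj G A g h \<Longrightarrow> \<bar>F g - F h\<bar> \<le> M"
  shows "\<bar>affine_extension F x - affine_extension F y\<bar> / M \<le> cayley_dist G A x y"
  using affine_extension_lipschitz[where F = F, OF _ F] assms
  by (intro cayley_dist_ge[OF assms(1)]) (auto simp: field_simps)

lemma cayley_dist_triangle:
  assumes "cayley_path G A x l y" "cayley_path G A y m z"
  shows "cayley_dist G A x z \<le> cayley_dist G A x y + cayley_dist G A y z"
proof -
  have "cayley_dist G A x z - l' \<le> cayley_dist G A y z" if "cayley_path G A x l' y" for l'
    using cayley_dist_le[OF cayley_path_trans[OF _ that]]
    by (intro cayley_dist_ge[OF assms(2)]) (simp add: diff_le_eq add.commute)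
  then have "cayley_dist G A x z - cayley_dist G A y z \<le> l'" if "cayley_path G A x l' y" for l'
    using that by (simp add: algebra_simps)
  then have "cayley_dist G A x z - cayley_dist G A y z \<le> cayley_dist G A x y"
    by (intro cayley_dist_ge[OF assms(1)])
  then show ?thesis by simp
qed

text \<open>The length of the path depends on \<open>a\<close> only, as left translations are isometries. This gives
  bounds that are uniform over the whole graph, for any set of generators.\<close>

lemma (in group) cayley_path_generate:
  assumes "A \<subseteq> carrier G" "a \<in> generate G A"
  shows "\<exists>l. \<forall>u\<in>carrier G. cayley_path G A (cayley_vertex u) l (cayley_vertex (u \<otimes> a))"
  using assms(2)
proof (induction rule: generate.induct)
  case one
  then show ?case by (intro exI[of _ 0]) (simp add: cayley_path_vertex)
next
  case (incl a)
  show ?case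
  proof (cases "a = \<one>")
    case True
    then show ?thesis by (intro exI[of _ 0]) (simp add: cayley_path_vertex)
  next
    case False
    have "cayley_adj G A u (u \<otimes> a)" if "u \<in> carrier G" for u
      using that incl assms False unfolding cayley_adj_def by (auto simp: subset_iff)
    then show ?thesis by (intro exI[of _ 1]) (simp add: cayley_path_edge)
  qed
next
  case (inv a)
  show ?case
  proof (cases "a = \<one>")
    case True
    then show ?thesis by (intro exI[of _ 0]) (simp add: cayley_path_vertex)
  next
    case False
    have a: "a \<in> carrier G" using inv assms by auto
    have "cayley_adj G A u (u \<otimes> inv a)" if "u \<in> carrier G" for u
    proof -
      have "u = u \<otimes> inv a \<otimes> a" using that a by (simp add: m_assoc)
      moreover have "u \<noteq> u \<otimes> inv a" using that a False by simp
      ultimately show ?thesis using that a inv unfolding cayley_adj_def by auto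
    qed
    then show ?thesis by (intro exI[of _ 1]) (simp add: cayley_path_edge)
  qed
next
  case (eng a b)
  then obtain k l where
    k: "\<forall>u\<in>carrier G. cayley_path G A (cayley_vertex u) k (cayley_vertex (u \<otimes> a))" and
    l: "\<forall>u\<in>carrier G. cayley_path G A (cayley_vertex u) l (cayley_vertex (u \<otimes> b))" by auto
  have ab: "a \<in> carrier G" "b \<in> carrier G"
    using eng generate_in_carrier assms by auto
  show ?case
  proof (intro exI ballI)
    fix u assume u: "u \<in> carrier G"
    show "cayley_path G A (cayley_vertex u) (k + l) (cayley_vertex (u \<otimes> (a \<otimes> b)))"
      using cayley_path_trans[OF l[rule_format] k[rule_format]] u ab by (simp add: m_assoc)
  qed
qed

lemma (in group) cayley_connected:
  assumes "A \<subseteq> carrier G" "generate G A = carrier G"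
    and "x \<in> cayley_points G A" "y \<in> cayley_points G A"
  obtains l where "cayley_path G A x l y"
proof -
  obtain g k where g: "g \<in> carrier G" "cayley_path G A x k (cayley_vertex g)"
    using near_vertex[OF assms(3)] by metis
  obtain h m where h: "h \<in> carrier G" "cayley_path G A y m (cayley_vertex h)"
    using near_vertex[OF assms(4)] by metis
  obtain l where "cayley_path G A (cayley_vertex g) l (cayley_vertex (g \<otimes> (inv g \<otimes> h)))"
    using cayley_path_generate[OF assms(1), of "inv g \<otimes> h"] assms(2) g h by auto
  then have "cayley_path G A (cayley_vertex g) l (cayley_vertex h)"
    using g h by (simp flip: m_assoc)
  then show thesis
    using that cayley_path_trans cayley_path_sym g(2) h(2) by metis
qed

section \<open>Excursions of discrete quasi-geodesics\<close>

text \<open>Cut the range from \<open>i\<close> to \<open>b\<close> into pieces of length \<open>\<tau>\<close>.\<close>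

lemma chain_bound:
  fixes \<epsilon> :: "nat \<Rightarrow> nat \<Rightarrow> real"
  assumes "\<tau> > 0"
    and short: "\<And>i j. \<lbrakk>a \<le> i; i \<le> j; j \<le> b; j - i \<le> \<tau>\<rbrakk> \<Longrightarrow> \<epsilon> i j \<le> c"
    and tri: "\<And>i j k. \<lbrakk>a \<le> i; i \<le> j; j \<le> k; k \<le> b\<rbrakk> \<Longrightarrow> \<epsilon> i k \<le> \<epsilon> i j + \<epsilon> j k"
    and "0 \<le> c" "a \<le> i" "i \<le> b"
  shows "\<epsilon> i b \<le> c * (real (b - i) / real \<tau> + 1)"
  using assms(5,6)
proof (induction "b - i" arbitrary: i rule: less_induct)
  case less
  show ?case
  proof (cases "b - i \<le> \<tau>")
    case True
    have "c * 1 \<le> c * (real (b - i) / real \<tau> + 1)"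
      using \<open>0 \<le> c\<close> by (intro mult_left_mono) auto
    then show ?thesis using short[OF less.prems(1,2) _ True] by simp
  next
    case False
    then have "\<epsilon> (i + \<tau>) b \<le> c * (real (b - (i + \<tau>)) / real \<tau> + 1)"
      using less \<open>\<tau> > 0\<close> by (intro less.hyps) auto
    moreover have "\<epsilon> i b \<le> \<epsilon> i (i + \<tau>) + \<epsilon> (i + \<tau>) b"
      using less.prems False by (intro tri) auto
    moreover have "\<epsilon> i (i + \<tau>) \<le> c" using less.prems False by (intro short) auto
    moreover have "c * (real (b - i) / real \<tau> + 1) = c * (real (b - (i + \<tau>)) / real \<tau> + 1) + c"
    proof -
      have "real (b - i) = real (b - (i + \<tau>)) + real \<tau>" using False by simp
      then show ?thesis using \<open>\<tau> > 0\<close> by (simp add: field_simps)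
    qed
    ultimately show ?thesis by linarith
  qed
qed

text \<open>The two constants are what the proof of \<open>excursion_bound\<close> yields: the time that a quasi-geodesic
  can spend outside the neighbourhood of radius \<open>\<kappa> * (4 * \<kappa> + 1) + \<beta> + 2\<close>, and the depth it can
  reach in that time.\<close>

definition excursion_length :: "real \<Rightarrow> real \<Rightarrow> real" where
  "excursion_length \<kappa> \<beta> = 2 * \<kappa> * (2 * (\<kappa> * (4 * \<kappa> + 1) + \<kappa> + 2 * \<beta> + 2) + \<beta> + 2)"

definition excursion_height :: "real \<Rightarrow> real \<Rightarrow> real" where
  "excursion_height \<kappa> \<beta> = \<kappa> * (4 * \<kappa> + 1) + 2 * \<beta> + \<kappa> + 2 + \<kappa> * excursion_length \<kappa> \<beta> + \<beta>"

text \<open>Here \<open>\<delta>\<close> stands for the distance of two points of a quasi-geodesic, \<open>D\<close> for the distance to a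
  subset, and \<open>\<epsilon>\<close> for the distance of the projections to it. As long as \<open>D\<close> exceeds the threshold
  \<open>E\<close>, points at most \<open>\<tau>\<close> steps apart are too close to each other for their projections to differ
  by more than \<open>2\<close>, because of \<open>contract\<close>. So an excursion of \<open>n\<close> steps moves the projection by
  only about \<open>2 * n / \<tau>\<close>, and since \<open>\<tau>\<close> is at least \<open>4 * \<kappa>\<close>, its ends would be much closer than
  a quasi-geodesic permits, unless \<open>n\<close> is bounded.\<close>

lemma excursion_bound:
  fixes \<delta> \<epsilon> :: "nat \<Rightarrow> nat \<Rightarrow> real" and D :: "nat \<Rightarrow> real"
  assumes "\<kappa> \<ge> 1" "\<beta> \<ge> 0"
    and upper: "\<And>i j. \<lbrakk>i \<le> j; j \<le> m\<rbrakk> \<Longrightarrow> \<delta> i j \<le> \<kappa> * real (j - i) + \<beta>"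
    and lower: "\<And>i j. \<lbrakk>i \<le> j; j \<le> m\<rbrakk> \<Longrightarrow> real (j - i) / \<kappa> - \<beta> \<le> \<delta> i j"
    and lip: "\<And>i j. \<lbrakk>i \<le> j; j \<le> m\<rbrakk> \<Longrightarrow> \<bar>D i - D j\<bar> \<le> \<delta> i j"
    and via: "\<And>i j. \<lbrakk>i \<le> j; j \<le> m\<rbrakk> \<Longrightarrow> \<delta> i j \<le> D i + \<epsilon> i j + D j"
    and contract: "\<And>i j. \<lbrakk>i \<le> j; j \<le> m; 2 < \<epsilon> i j\<rbrakk> \<Longrightarrow> D i + D j \<le> \<delta> i j + 2"
    and tri: "\<And>i j k. \<lbrakk>i \<le> j; j \<le> k; k \<le> m\<rbrakk> \<Longrightarrow> \<epsilon> i k \<le> \<epsilon> i j + \<epsilon> j k"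
    and ends: "D 0 = 0" "D m = 0" and "i \<le> m"
  shows "D i \<le> excursion_height \<kappa> \<beta>"
proof -
  (* E is at least the largest distance that tau steps can cover, plus the error 2 of contract. *)
  define \<tau> where "\<tau> = nat \<lceil>4 * \<kappa>\<rceil>"
  define E where "E = \<kappa> * (4 * \<kappa> + 1) + \<beta> + 2"
  have \<tau>: "4 * \<kappa> \<le> real \<tau>" "real \<tau> \<le> 4 * \<kappa> + 1" "0 < \<tau>"
    using \<open>\<kappa> \<ge> 1\<close> unfolding \<tau>_def by linarith+
  have height: "excursion_height \<kappa> \<beta> = E + \<kappa> + \<beta> + \<kappa> * excursion_length \<kappa> \<beta> + \<beta>"
    unfolding excursion_height_def E_def by simp
  have E0: "0 \<le> E" unfolding E_def using assms(1,2) by simp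
  have len0: "0 \<le> excursion_length \<kappa> \<beta>"
    unfolding excursion_length_def using assms(1,2) by simp
  show ?thesis
  proof (cases "D i \<le> E")
    case True
    moreover have "0 \<le> \<kappa> * excursion_length \<kappa> \<beta>" using assms(1) len0 by simp
    ultimately show ?thesis unfolding height using assms(1,2) by linarith
  next
    case False
    (* a and b are the last time before i and the first time after i at which D is at most E. *)
    define a where "a = (GREATEST j. j \<le> i \<and> D j \<le> E)"
    define b where "b = (LEAST j. i \<le> j \<and> D j \<le> E)"
    have a: "a \<le> i" "D a \<le> E"
      using GreatestI_nat[of "\<lambda>j. j \<le> i \<and> D j \<le> E" 0 i] ends E0 unfolding a_def by auto
    have a_max: "j \<le> a" if "j \<le> i" "D j \<le> E" for j
      using Greatest_le_nat[of "\<lambda>j. j \<le> i \<and> D j \<le> E" j i] that unfolding a_def by auto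
    have b: "i \<le> b" "D b \<le> E"
      using LeastI[of "\<lambda>j. i \<le> j \<and> D j \<le> E" m] ends E0 \<open>i \<le> m\<close> unfolding b_def by auto
    have b_min: "b \<le> j" if "i \<le> j" "D j \<le> E" for j
      using Least_le[of "\<lambda>j. i \<le> j \<and> D j \<le> E" j] that unfolding b_def by auto
    have "b \<le> m" using b_min[of m] \<open>i \<le> m\<close> ends E0 by simp
    have ab: "a < i" "i < b" using a b False by (auto simp: order.order_iff_strict)
    have far: "E < D j" if "a < j" "j < b" for j
      using a_max[of j] b_min[of j] that by (meson le_cases not_le)
    have close: "\<epsilon> j k \<le> 2" if "Suc a \<le> j" "j \<le> k" "k \<le> b - 1" "k - j \<le> \<tau>" for j k
    proof (rule ccontr)
      assume "\<not> \<epsilon> j k \<le> 2"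
      then have "D j + D k \<le> \<delta> j k + 2" using that \<open>b \<le> m\<close> by (intro contract) auto
      moreover have "\<delta> j k \<le> \<kappa> * real (k - j) + \<beta>" using that \<open>b \<le> m\<close> by (intro upper) auto
      moreover have "\<kappa> * real (k - j) \<le> \<kappa> * (4 * \<kappa> + 1)"
        using that(4) \<tau> \<open>\<kappa> \<ge> 1\<close> by (intro mult_left_mono) auto
      moreover have "E < D j" "E < D k" using far that ab by auto
      ultimately show False using E0 unfolding E_def by simp
    qed
    define n where "n = real (b - 1 - Suc a)"
    have "\<epsilon> (Suc a) (b - 1) \<le> 2 * (n / real \<tau> + 1)"
      unfolding n_def using \<tau> ab \<open>b \<le> m\<close> by (intro chain_bound[where a = "Suc a"] close tri) auto
    moreover have "n / real \<tau> \<le> n / (4 * \<kappa>)"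
      unfolding n_def using \<tau> \<open>\<kappa> \<ge> 1\<close> by (intro divide_left_mono) auto
    moreover have "n / \<kappa> - \<beta> \<le> D (Suc a) + \<epsilon> (Suc a) (b - 1) + D (b - 1)"
      unfolding n_def using ab \<open>b \<le> m\<close>
      by (intro order_trans[OF lower via]) auto
    moreover have Da: "D (Suc a) \<le> E + \<kappa> + \<beta>"
      using lip[of a "Suc a"] upper[of a "Suc a"] a ab \<open>b \<le> m\<close> by simp
    moreover have "D (b - 1) \<le> E + \<kappa> + \<beta>"
      using lip[of "b - 1" b] upper[of "b - 1" b] b ab \<open>b \<le> m\<close> by simp
    ultimately have "n / \<kappa> \<le> 2 * (E + \<kappa> + \<beta>) + 2 * (n / (4 * \<kappa>) + 1) + \<beta>" by simp
    then have "n / \<kappa> \<le> 2 * (2 * (E + \<kappa> + \<beta>) + \<beta> + 2)" by (simp add: field_simps)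
    then have "n \<le> excursion_length \<kappa> \<beta>"
      using \<open>\<kappa> \<ge> 1\<close> unfolding excursion_length_def E_def by (simp add: field_simps)
    moreover have "\<kappa> * real (i - Suc a) \<le> \<kappa> * n"
      unfolding n_def using ab \<open>\<kappa> \<ge> 1\<close> by (intro mult_left_mono) auto
    ultimately have "\<kappa> * real (i - Suc a) \<le> \<kappa> * excursion_length \<kappa> \<beta>"
      using \<open>\<kappa> \<ge> 1\<close> by (meson mult_left_mono order_trans zero_le_one)
    moreover have "\<delta> (Suc a) i \<le> \<kappa> * real (i - Suc a) + \<beta>"
      using ab \<open>b \<le> m\<close> by (intro upper) auto
    moreover have "\<bar>D (Suc a) - D i\<bar> \<le> \<delta> (Suc a) i"
      using ab \<open>b \<le> m\<close> by (intro lip) auto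
    ultimately show ?thesis unfolding height using Da by simp
  qed
qed

lemma discrete_intermediate_value:
  fixes H :: "nat \<Rightarrow> real"
  assumes "H 0 \<le> c" "c \<le> H m" "\<And>i. i < m \<Longrightarrow> \<bar>H (Suc i) - H i\<bar> \<le> \<mu>" "0 \<le> \<mu>"
  shows "\<exists>j\<le>m. \<bar>H j - c\<bar> \<le> \<mu>"
proof -
  define j where "j = (LEAST j. c \<le> H j)"
  have j: "c \<le> H j" "j \<le> m" unfolding j_def using assms(2) by (auto intro: LeastI Least_le)
  show ?thesis
  proof (cases j)
    case 0
    then show ?thesis using j assms by (intro exI[of _ 0]) auto
  next
    case (Suc i)
    then have "\<not> c \<le> H i" using not_less_Least[of i "\<lambda>j. c \<le> H j"] unfolding j_def by simp
    then show ?thesis using j Suc assms(3)[of i] by (intro exI[of _ j]) auto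
  qed
qed

section \<open>Acting on a set by commuting involutions\<close>

text \<open>A presented group acts on a set as soon as its generators act compatibly with the relations.
  All words in a class \<open>X\<close> then act in the same way, so any representative will do. Relevant are the
  action on sets of reflections, which yields the walls, the actions on the integer line through
  infinite dihedral quotients, and the parities of the numbers of occurrences of a letter.\<close>

definition racg_action :: "('a \<Rightarrow> 'x \<Rightarrow> 'x) \<Rightarrow> 'a word set \<Rightarrow> 'x \<Rightarrow> 'x" where
  "racg_action f X = foldr (\<lambda>l. f (fst l)) (SOME w. w \<in> X)"

definition racg_involutions :: "'a pair_pre_digraph \<Rightarrow> ('a \<Rightarrow> 'x \<Rightarrow> 'x) \<Rightarrow> bool" where
  "racg_involutions \<Gamma> f \<longleftrightarrow>
     (\<forall>s\<in>pverts \<Gamma>. \<forall>x. f s (f s x) = x) \<and> (\<forall>(s, t)\<in>parcs \<Gamma>. \<forall>x. f s (f t x) = f t (f s x))"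

locale coxeter_graph =
  fixes \<Gamma> :: "'a pair_pre_digraph"
  assumes simple_graph: "pair_graph \<Gamma>"
begin

abbreviation mul (infixl "\<cdot>" 70) where "x \<cdot> y \<equiv> x \<otimes>\<^bsub>racg \<Gamma>\<^esub> y"
abbreviation e where "e \<equiv> \<one>\<^bsub>racg \<Gamma>\<^esub>"
abbreviation iv where "iv x \<equiv> inv\<^bsub>racg \<Gamma>\<^esub> x"
abbreviation W where "W \<equiv> carrier (racg \<Gamma>)"
abbreviation S where "S \<equiv> pverts \<Gamma>"
abbreviation \<sigma> where "\<sigma> \<equiv> racg_gen \<Gamma>"
abbreviation adj where "adj s t \<equiv> (s, t) \<in> parcs \<Gamma>"

sublocale G: group "racg \<Gamma>"
  by (simp add: racg_def presented_group_group)

lemma adj_sym: "adj s t \<Longrightarrow> adj t s"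
proof -
  interpret pair_graph \<Gamma> by (rule simple_graph)
  show "adj s t \<Longrightarrow> adj t s" by (rule arcs_symmetric)
qed

lemma adj_verts: "adj s t \<Longrightarrow> s \<in> S \<and> t \<in> S"
proof -
  interpret pair_graph \<Gamma> by (rule simple_graph)
  show "adj s t \<Longrightarrow> s \<in> S \<and> t \<in> S" by (auto dest: in_arcsD1 in_arcsD2)
qed

lemma adj_irrefl: "\<not> adj s s"
proof -
  interpret pair_graph \<Gamma> by (rule simple_graph)
  show ?thesis using pair_no_loops by fastforce
qed

lemma finite_S: "finite S"
proof -
  interpret pair_graph \<Gamma> by (rule simple_graph)
  show ?thesis by (rule pair_finite_verts)
qed

abbreviation rel where "rel \<equiv> word_rel S (racg_relations \<Gamma>)"

lemma foldr_word_rel: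
  assumes "racg_involutions \<Gamma> f" "(u, v) \<in> rel"
  shows "foldr (\<lambda>l. f (fst l)) u = foldr (\<lambda>l. f (fst l)) v"
  using assms(2)
proof (induction rule: word_rel.induct)
  case (word_relation u v)
  then show ?case using assms(1)
    by (auto simp: racg_relations_def racg_involutions_def fun_eq_iff)
next
  case (word_cancel s b)
  then show ?case using assms(1) by (auto simp: racg_involutions_def fun_eq_iff)
next
  case (word_compat u v x y)
  then show ?case by simp
next
  case (word_trans u v w)
  show ?case using word_trans.IH by (rule HOL.trans)
next
  case (word_sym u v)
  show ?case using word_sym.IH by (rule HOL.sym)
qed (rule refl)

lemma racg_action_class:
  assumes "racg_involutions \<Gamma> f" "w \<in> words S"
  shows "racg_action f (rel `` {w}) = foldr (\<lambda>l. f (fst l)) w"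
proof -
  have "(SOME v. v \<in> rel `` {w}) \<in> rel `` {w}"
    using word_rel.word_refl[OF assms(2)] by (intro someI[where P = "\<lambda>v. v \<in> rel `` {w}"]) auto
  then have "(w, SOME v. v \<in> rel `` {w}) \<in> rel" by simp
  from foldr_word_rel[OF assms(1) this] show ?thesis by (simp only: racg_action_def)
qed

lemma carrier_class: "g \<in> W \<Longrightarrow> \<exists>w \<in> words S. g = rel `` {w}"
  by (auto simp: racg_def presented_group_def quotient_def)

lemma gen_class: "\<sigma> s = rel `` {[(s, True)]}"
  by (simp add: racg_gen_def presented_gen_def)

lemma one_class: "e = rel `` {[]}"
  by (simp add: racg_def presented_group_def)

lemma mul_class: "u \<in> words S \<Longrightarrow> v \<in> words S \<Longrightarrow> (rel `` {u}) \<cdot> (rel `` {v}) = rel `` {u @ v}"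
  by (simp add: racg_def presented_group_mult_class)

lemma class_eqI: "(u, v) \<in> rel \<Longrightarrow> rel `` {u} = rel `` {v}"
  by (rule equiv_class_eq[OF equiv_word_rel])

lemma gen_closed [simp, intro]: "s \<in> S \<Longrightarrow> \<sigma> s \<in> W"
  by (auto simp: gen_class racg_def presented_group_def intro!: quotientI)

lemma gen_gen [simp]: "s \<in> S \<Longrightarrow> \<sigma> s \<cdot> \<sigma> s = e"
  unfolding gen_class one_class
  by (subst mul_class, simp, simp, rule class_eqI, rule word_rel.word_relation)
    (auto simp: racg_relations_def)

lemma gen_commute: "adj s t \<Longrightarrow> \<sigma> s \<cdot> \<sigma> t = \<sigma> t \<cdot> \<sigma> s"
  using adj_verts[of s t] unfolding gen_class
  by (subst (1 2) mul_class, simp_all, intro class_eqI word_rel.word_relation)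
    (auto simp: racg_relations_def)

lemma inv_gen [simp]: "s \<in> S \<Longrightarrow> iv (\<sigma> s) = \<sigma> s"
  by (simp add: G.inv_equality)

lemma cancel [simp]:
  "x \<in> W \<Longrightarrow> y \<in> W \<Longrightarrow> iv x \<cdot> (x \<cdot> y) = y"
  "x \<in> W \<Longrightarrow> y \<in> W \<Longrightarrow> x \<cdot> (iv x \<cdot> y) = y"
  "s \<in> S \<Longrightarrow> y \<in> W \<Longrightarrow> \<sigma> s \<cdot> (\<sigma> s \<cdot> y) = y"
  by (simp_all flip: G.m_assoc)

lemmas grp = G.m_assoc G.inv_mult_group

lemma gen_commute': "adj s t \<Longrightarrow> x \<in> W \<Longrightarrow> \<sigma> s \<cdot> (\<sigma> t \<cdot> x) = \<sigma> t \<cdot> (\<sigma> s \<cdot> x)"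
  using adj_verts[of s t] gen_commute[of s t] by (simp flip: G.m_assoc)

lemma racg_action:
  assumes "racg_involutions \<Gamma> f"
  shows racg_action_one: "racg_action f e = id"
    and racg_action_mult: "g \<in> W \<Longrightarrow> h \<in> W \<Longrightarrow>
      racg_action f (g \<cdot> h) x = racg_action f g (racg_action f h x)"
    and racg_action_gen: "s \<in> S \<Longrightarrow> racg_action f (\<sigma> s) = f s"
proof -
  show "racg_action f e = id"
    by (simp add: one_class racg_action_class[OF assms])
  show "racg_action f (\<sigma> s) = f s" if "s \<in> S"
    using that by (simp add: gen_class racg_action_class[OF assms] fun_eq_iff)
  show "racg_action f (g \<cdot> h) x = racg_action f g (racg_action f h x)" if gh: "g \<in> W" "h \<in> W"
  proof -
    obtain u v where "u \<in> words S" "g = rel `` {u}" "v \<in> words S" "h = rel `` {v}"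
      using gh carrier_class by meson
    then show ?thesis by (simp add: mul_class racg_action_class[OF assms])
  qed
qed

section \<open>Words in the generators\<close>

definition ev :: "'a list \<Rightarrow> 'a word set" where
  "ev w = foldr (\<lambda>s g. \<sigma> s \<cdot> g) w e"

lemma ev_simps [simp]: "ev [] = e" "ev (s # w) = \<sigma> s \<cdot> ev w"
  by (simp_all add: ev_def)

lemma ev_closed [simp, intro]: "set w \<subseteq> S \<Longrightarrow> ev w \<in> W"
  by (induction w) auto

lemma ev_append: "set u \<subseteq> S \<Longrightarrow> set v \<subseteq> S \<Longrightarrow> ev (u @ v) = ev u \<cdot> ev v"
  by (induction u) (auto simp: grp)

lemma inv_ev: "set u \<subseteq> S \<Longrightarrow> iv (ev u) = ev (rev u)"
  by (induction u) (auto simp: grp ev_append)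

lemma ev_surj: "g \<in> W \<Longrightarrow> \<exists>w. set w \<subseteq> S \<and> g = ev w"
proof -
  have "\<exists>w. set w \<subseteq> S \<and> rel `` {u} = ev w" if "u \<in> words S" for u
    using that
  proof (induction u)
    case Nil
    then show ?case by (intro exI[of _ "[]"]) (simp add: one_class)
  next
    case (Cons l u)
    obtain s b where l: "l = (s, b)" by (cases l)
    have s: "s \<in> S" "u \<in> words S" using Cons l by auto
    obtain w where w: "set w \<subseteq> S" "rel `` {u} = ev w" using Cons s by auto
    have "rel `` {[(s, b)]} = \<sigma> s"
    proof (cases b)
      case False
      have "([(s, True), (s, True)] @ [(s, False)], [] @ [(s, False)]) \<in> rel"
        using s by (intro word_rel_append word_rel.word_relation word_rel.word_refl)
          (auto simp: racg_relations_def)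
      moreover have "([(s, True)] @ [(s, True), (s, \<not> True)], [(s, True)] @ []) \<in> rel"
        using s by (intro word_rel_append word_rel.word_cancel word_rel.word_refl) auto
      ultimately have "([(s, False)], [(s, True)]) \<in> rel"
        by (auto intro: word_rel.word_trans word_rel.word_sym)
      with False show ?thesis by (simp add: gen_class class_eqI)
    qed (simp add: gen_class)
    then have "rel `` {l # u} = \<sigma> s \<cdot> ev w"
      using mul_class[of "[(s, b)]" u] s w l by simp
    then show ?case using w s by (intro exI[of _ "s # w"]) auto
  qed
  then show "g \<in> W \<Longrightarrow> ?thesis" using carrier_class by fastforce
qed

lemma racg_induct [consumes 1, case_names one mult]:
  assumes "g \<in> W" "P e" "\<And>s h. s \<in> S \<Longrightarrow> h \<in> W \<Longrightarrow> P h \<Longrightarrow> P (\<sigma> s \<cdot> h)"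
  shows "P g"
proof -
  have "P (ev w)" if "set w \<subseteq> S" for w
    using that assms(2,3) by (induction w) auto
  then show ?thesis using ev_surj[OF assms(1)] by auto
qed

lemma generate_ev:
  assumes "U \<subseteq> S"
  shows "generate (racg \<Gamma>) (\<sigma> ` U) = {ev w | w. set w \<subseteq> U}"
proof
  show "generate (racg \<Gamma>) (\<sigma> ` U) \<subseteq> {ev w | w. set w \<subseteq> U}"
  proof
    fix g assume "g \<in> generate (racg \<Gamma>) (\<sigma> ` U)"
    then show "g \<in> {ev w | w. set w \<subseteq> U}"
    proof (induction rule: generate.induct)
      case one
      then show ?case by (auto intro!: exI[of _ "[]"])
    next
      case (incl h)
      then obtain s where "s \<in> U" "h = \<sigma> s" by auto
      then show ?case using assms by (auto intro!: exI[of _ "[s]"])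
    next
      case (inv h)
      then obtain s where "s \<in> U" "h = \<sigma> s" by auto
      then show ?case using assms by (auto intro!: exI[of _ "[s]"])
    next
      case (eng g h)
      then obtain u v where "set u \<subseteq> U" "set v \<subseteq> U" "g = ev u" "h = ev v" by auto
      then show ?case using assms by (auto intro!: exI[of _ "u @ v"] simp: ev_append)
    qed
  qed
  have "ev w \<in> generate (racg \<Gamma>) (\<sigma> ` U)" if "set w \<subseteq> U" for w
    using that by (induction w) (auto intro: generate.intros)
  then show "{ev w | w. set w \<subseteq> U} \<subseteq> generate (racg \<Gamma>) (\<sigma> ` U)" by auto
qed

definition parity :: "'a \<Rightarrow> 'a \<Rightarrow> bool \<Rightarrow> bool" where
  "parity s u z = ((u = s) \<noteq> z)"

text \<open>The parity of the number of occurrences of \<open>s\<close> in a word is an invariant of its class.\<close>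

lemma gen_notin_subgroup:
  assumes "s \<in> S" "U \<subseteq> S" "s \<notin> U"
  shows "\<sigma> s \<notin> generate (racg \<Gamma>) (\<sigma> ` U)"
proof
  have inv: "racg_involutions \<Gamma> (parity s)"
    by (auto simp: racg_involutions_def parity_def)
  have "racg_action (parity s) (ev w) z = z" if "set w \<subseteq> U" for w z
    using that
  proof (induction w)
    case (Cons u w)
    then have "u \<in> S" "u \<noteq> s" "set w \<subseteq> S" using assms by auto
    moreover have "parity s u z = z" using \<open>u \<noteq> s\<close> by (simp add: parity_def)
    ultimately show ?case using Cons
      by (simp add: racg_action_mult[OF inv] racg_action_gen[OF inv])
  qed (simp add: racg_action_one[OF inv])
  moreover assume "\<sigma> s \<in> generate (racg \<Gamma>) (\<sigma> ` U)"
  ultimately have "racg_action (parity s) (\<sigma> s) True = True"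
    unfolding generate_ev[OF assms(2)] by auto
  then show False using racg_action_gen[OF inv assms(1)] by (simp add: parity_def)
qed

lemma gen_eq_iff: "s \<in> S \<Longrightarrow> t \<in> S \<Longrightarrow> \<sigma> s = \<sigma> t \<longleftrightarrow> s = t"
  using gen_notin_subgroup[of s "{t}"] generate.incl[of "\<sigma> t" "\<sigma> ` {t}" "racg \<Gamma>"]
  by (metis empty_subsetI image_insert image_empty insertI1 insert_subset singletonD)

section \<open>The walls separating two group elements\<close>

text \<open>On sets of group elements this is \<open>X \<mapsto> {\<sigma> s} \<triangle> \<sigma> s X \<sigma> s\<close>. Objects outside of the group are kept,
  which makes the map an involution on all sets.\<close>

definition wall_involution :: "'a \<Rightarrow> 'a word set set \<Rightarrow> 'a word set set" where
  "wall_involution s X =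
     {r. (r = \<sigma> s) \<noteq> (if r \<in> W then \<sigma> s \<cdot> r \<cdot> \<sigma> s \<in> X else r \<in> X)}"

text \<open>For a word \<open>s\<^sub>1 \<dots> s\<^sub>n\<close> this is the symmetric difference of the singletons of the reflections
  \<open>s\<^sub>1 \<dots> s\<^sub>i \<dots> s\<^sub>1\<close>, which belong to the edges of the path that the word describes: a wall that is
  crossed an even number of times does not separate the ends.\<close>

definition walls :: "'a word set \<Rightarrow> 'a word set set" where
  "walls g = racg_action wall_involution g {}"

lemma conj_eq_gen_iff:
  assumes "s \<in> S" "r \<in> W"
  shows "\<sigma> s \<cdot> r \<cdot> \<sigma> s = \<sigma> s \<longleftrightarrow> r = \<sigma> s"
proof
  assume "\<sigma> s \<cdot> r \<cdot> \<sigma> s = \<sigma> s"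
  then have "\<sigma> s \<cdot> (\<sigma> s \<cdot> r \<cdot> \<sigma> s) \<cdot> \<sigma> s = \<sigma> s \<cdot> \<sigma> s \<cdot> \<sigma> s" by simp
  then show "r = \<sigma> s" using assms by (simp add: grp)
qed (use assms in simp)

lemma gen_mult_eq_one_iff: "s \<in> S \<Longrightarrow> r \<in> W \<Longrightarrow> \<sigma> s \<cdot> r = e \<longleftrightarrow> r = \<sigma> s"
  using cancel(3)[of s r] by fastforce

lemma wall_involutions: "racg_involutions \<Gamma> wall_involution"
  unfolding racg_involutions_def
proof (intro conjI ballI allI; (clarify)?)
  fix s X assume s: "s \<in> S"
  have *: "\<sigma> s \<cdot> (\<sigma> s \<cdot> r \<cdot> \<sigma> s) \<cdot> \<sigma> s = r" if "r \<in> W" for r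
    using s that by (simp add: grp)
  show "wall_involution s (wall_involution s X) = X"
  proof (rule Set.set_eqI)
    fix r show "r \<in> wall_involution s (wall_involution s X) \<longleftrightarrow> r \<in> X"
      by (cases "r \<in> W"; cases "r = \<sigma> s")
        (use s in \<open>simp_all add: wall_involution_def conj_eq_gen_iff gen_mult_eq_one_iff *\<close>)
  qed
next
  fix s t X assume st: "adj s t"
  have "wall_involution s (wall_involution t X) = {r. ((r = \<sigma> s) \<noteq> (r = \<sigma> t)) \<noteq>
     (if r \<in> W then \<sigma> s \<cdot> \<sigma> t \<cdot> r \<cdot> \<sigma> t \<cdot> \<sigma> s \<in> X else r \<in> X)}" if st: "adj s t" for s t
  proof -
    have st': "s \<in> S" "t \<in> S" using adj_verts st by auto
    have "\<sigma> s \<cdot> r \<cdot> \<sigma> s = \<sigma> t \<longleftrightarrow> r = \<sigma> t" if "r \<in> W" for r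
    proof
      assume "\<sigma> s \<cdot> r \<cdot> \<sigma> s = \<sigma> t"
      then have "\<sigma> s \<cdot> (\<sigma> s \<cdot> r \<cdot> \<sigma> s) \<cdot> \<sigma> s = \<sigma> s \<cdot> \<sigma> t \<cdot> \<sigma> s" by simp
      then show "r = \<sigma> t" using that st' gen_commute[OF st] by (simp add: grp)
    qed (use that st' gen_commute[OF st] in \<open>simp add: grp\<close>)
    moreover have "\<sigma> t \<cdot> (\<sigma> s \<cdot> r \<cdot> \<sigma> s) \<cdot> \<sigma> t = \<sigma> s \<cdot> \<sigma> t \<cdot> r \<cdot> \<sigma> t \<cdot> \<sigma> s" if "r \<in> W" for r
      using that st' gen_commute[OF st] gen_commute'[OF st] by (simp add: grp)
    ultimately show ?thesis
      using st' by (intro Set.set_eqI) (simp add: wall_involution_def, blast)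
  qed
  note this[OF st] this[OF adj_sym[OF st]]
  moreover have "\<sigma> s \<cdot> \<sigma> t \<cdot> r \<cdot> \<sigma> t \<cdot> \<sigma> s = \<sigma> t \<cdot> \<sigma> s \<cdot> r \<cdot> \<sigma> s \<cdot> \<sigma> t" if "r \<in> W" for r
    using that adj_verts[OF st] gen_commute[OF st] gen_commute'[OF st] by (simp add: grp)
  ultimately show "wall_involution s (wall_involution t X) = wall_involution t (wall_involution s X)"
    by (intro Set.set_eqI) (simp, blast)
qed

lemma walls_one [simp]: "walls e = {}"
  by (simp add: walls_def racg_action_one[OF wall_involutions])

lemma walls_gen_mult':
  "s \<in> S \<Longrightarrow> g \<in> W \<Longrightarrow> walls (\<sigma> s \<cdot> g) = wall_involution s (walls g)"
  by (simp add: walls_def racg_action_mult[OF wall_involutions] racg_action_gen[OF wall_involutions])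

lemma walls_closed: "g \<in> W \<Longrightarrow> walls g \<subseteq> W"
  by (induction rule: racg_induct) (auto simp: walls_gen_mult' wall_involution_def split: if_splits)

lemma walls_gen_mult:
  "s \<in> S \<Longrightarrow> g \<in> W \<Longrightarrow> r \<in> W \<Longrightarrow>
    r \<in> walls (\<sigma> s \<cdot> g) \<longleftrightarrow> (r = \<sigma> s) \<noteq> (\<sigma> s \<cdot> r \<cdot> \<sigma> s \<in> walls g)"
  by (auto simp: walls_gen_mult' wall_involution_def)

lemma walls_gen [simp]: "s \<in> S \<Longrightarrow> walls (\<sigma> s) = {\<sigma> s}"
  using walls_gen_mult[of s e] walls_closed[of "\<sigma> s"] by auto

text \<open>The path to \<open>g \<cdot> h\<close> is the path to \<open>g\<close>, followed by the translate by \<open>g\<close> of the path to \<open>h\<close>.\<close>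

lemma walls_mult:
  assumes "g \<in> W" "h \<in> W" "r \<in> W"
  shows "r \<in> walls (g \<cdot> h) \<longleftrightarrow> (r \<in> walls g) \<noteq> (iv g \<cdot> r \<cdot> g \<in> walls h)"
  using assms
proof (induction arbitrary: r rule: racg_induct)
  case (mult s g)
  then have "r \<in> walls (\<sigma> s \<cdot> g \<cdot> h) \<longleftrightarrow> (r = \<sigma> s) \<noteq> (\<sigma> s \<cdot> r \<cdot> \<sigma> s \<in> walls (g \<cdot> h))"
    by (simp add: G.m_assoc walls_gen_mult)
  also have "\<dots> \<longleftrightarrow> (r = \<sigma> s) \<noteq> ((\<sigma> s \<cdot> r \<cdot> \<sigma> s \<in> walls g) \<noteq>
      (iv g \<cdot> (\<sigma> s \<cdot> r \<cdot> \<sigma> s) \<cdot> g \<in> walls h))"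
    using mult by simp
  also have "iv g \<cdot> (\<sigma> s \<cdot> r \<cdot> \<sigma> s) \<cdot> g = iv (\<sigma> s \<cdot> g) \<cdot> r \<cdot> (\<sigma> s \<cdot> g)"
    using mult by (simp add: grp)
  finally show ?case using mult by (auto simp: walls_gen_mult)
qed auto

text \<open>Translating by \<open>v\<close> moves the walls between \<open>v\<close> and \<open>x\<close> to those between \<open>1\<close> and
  \<open>v\<inverse>x\<close>.\<close>

lemma walls_translate:
  assumes "v \<in> W" "x \<in> W" "r \<in> W"
  shows "iv v \<cdot> r \<cdot> v \<in> walls (iv v \<cdot> x) \<longleftrightarrow> (r \<in> walls v) \<noteq> (r \<in> walls x)"
  using walls_mult[of v "iv v \<cdot> x" r] assms by auto

text \<open>This is the word length: by \<open>first_letter\<close> and \<open>len_gen_mult\<close>, a letter can be split off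
  every non-trivial element such that the number of walls drops by one.\<close>

definition len :: "'a word set \<Rightarrow> nat" where
  "len g = card (walls g)"

definition wdist :: "'a word set \<Rightarrow> 'a word set \<Rightarrow> nat" where
  "wdist x y = len (iv x \<cdot> y)"

lemma finite_walls [simp]: "g \<in> W \<Longrightarrow> finite (walls g)"
proof (induction rule: racg_induct)
  case (mult s g)
  have "walls (\<sigma> s \<cdot> g) \<subseteq> insert (\<sigma> s) ((\<lambda>r. \<sigma> s \<cdot> r \<cdot> \<sigma> s) ` walls g)"
  proof
    fix r assume r: "r \<in> walls (\<sigma> s \<cdot> g)"
    then have "r \<in> W" using walls_closed[of "\<sigma> s \<cdot> g"] mult by auto
    moreover have "r = \<sigma> s \<cdot> (\<sigma> s \<cdot> r \<cdot> \<sigma> s) \<cdot> \<sigma> s" using \<open>r \<in> W\<close> mult by (simp add: grp)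
    ultimately show "r \<in> insert (\<sigma> s) ((\<lambda>r. \<sigma> s \<cdot> r \<cdot> \<sigma> s) ` walls g)"
      using r walls_gen_mult[of s g r] mult by blast
  qed
  then show ?case using mult finite_subset by blast
qed auto

lemma card_conj:
  assumes "v \<in> W" "X \<subseteq> W"
  shows "card ((\<lambda>r. iv v \<cdot> r \<cdot> v) ` X) = card X"
proof (rule card_image, rule inj_onI)
  fix r q assume "r \<in> X" "q \<in> X" and eq: "iv v \<cdot> r \<cdot> v = iv v \<cdot> q \<cdot> v"
  then have "r \<in> W" "q \<in> W" using assms by auto
  then show "r = q"
    using arg_cong[OF eq, of "\<lambda>z. v \<cdot> z \<cdot> iv v"] assms by (simp add: grp)
qed

lemma walls_translate_image:
  assumes "v \<in> W" "x \<in> W"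
  shows "walls (iv v \<cdot> x) = (\<lambda>r. iv v \<cdot> r \<cdot> v) ` sym_diff (walls v) (walls x)"
proof (intro Set.set_eqI iffI)
  fix q assume q: "q \<in> walls (iv v \<cdot> x)"
  have "q \<in> W" using q walls_closed[of "iv v \<cdot> x"] assms by auto
  then have "q = iv v \<cdot> (v \<cdot> q \<cdot> iv v) \<cdot> v" using assms by (simp add: grp)
  moreover have "v \<cdot> q \<cdot> iv v \<in> sym_diff (walls v) (walls x)"
    using walls_translate[of v x "v \<cdot> q \<cdot> iv v"] calculation q assms \<open>q \<in> W\<close> by auto
  ultimately show "q \<in> (\<lambda>r. iv v \<cdot> r \<cdot> v) ` sym_diff (walls v) (walls x)" by blast
next
  fix q assume "q \<in> (\<lambda>r. iv v \<cdot> r \<cdot> v) ` sym_diff (walls v) (walls x)"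
  then show "q \<in> walls (iv v \<cdot> x)"
    using walls_translate[OF assms] walls_closed assms by blast
qed

lemma wdist_walls:
  assumes "x \<in> W" "y \<in> W"
  shows "wdist x y = card (sym_diff (walls x) (walls y))"
proof -
  have "sym_diff (walls x) (walls y) \<subseteq> W" using walls_closed assms by blast
  then show ?thesis unfolding wdist_def len_def
    using assms by (simp only: walls_translate_image card_conj)
qed

lemma len_gen_mult:
  assumes "s \<in> S" "g \<in> W"
  shows "\<sigma> s \<in> walls g \<Longrightarrow> len g = Suc (len (\<sigma> s \<cdot> g))"
    and "\<sigma> s \<notin> walls g \<Longrightarrow> len (\<sigma> s \<cdot> g) = Suc (len g)"
proof -
  have *: "len (\<sigma> s \<cdot> g) = card (sym_diff {\<sigma> s} (walls g))"
    using wdist_walls[of "\<sigma> s" g] assms by (simp add: wdist_def)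
  show "len g = Suc (len (\<sigma> s \<cdot> g))" if "\<sigma> s \<in> walls g"
  proof -
    have "sym_diff {\<sigma> s} (walls g) = walls g - {\<sigma> s}" using that by auto
    then show ?thesis using * that assms unfolding len_def
      by (metis card.remove finite_walls)
  qed
  show "len (\<sigma> s \<cdot> g) = Suc (len g)" if "\<sigma> s \<notin> walls g"
  proof -
    have "sym_diff {\<sigma> s} (walls g) = insert (\<sigma> s) (walls g)" using that by auto
    then show ?thesis using * that assms unfolding len_def by simp
  qed
qed

lemma gen_in_walls_gen_mult:
  assumes "s \<in> S" "g \<in> W"
  shows "\<sigma> s \<in> walls (\<sigma> s \<cdot> g) \<longleftrightarrow> \<sigma> s \<notin> walls g"
  using walls_gen_mult[of s g "\<sigma> s"] assms by auto

lemma walls_ev: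
  assumes "set w \<subseteq> S" "r \<in> walls (ev w)"
  shows "\<exists>u a v. w = u @ a # v \<and> r = ev (u @ a # rev u)"
  using assms
proof (induction w arbitrary: r)
  case (Cons s w)
  have sw: "s \<in> S" "ev w \<in> W" "set w \<subseteq> S" using Cons.prems by auto
  have r: "r \<in> W" using walls_closed[of "ev (s # w)"] Cons.prems by auto
  show ?case
  proof (cases "r = \<sigma> s")
    case True
    then show ?thesis using sw by (intro exI[of _ "[]"] exI[of _ s] exI[of _ w]) auto
  next
    case False
    then have "\<sigma> s \<cdot> r \<cdot> \<sigma> s \<in> walls (ev w)"
      using Cons.prems walls_gen_mult[OF sw(1,2) r] by simp
    then obtain u a v where uv: "w = u @ a # v" "\<sigma> s \<cdot> r \<cdot> \<sigma> s = ev (u @ a # rev u)"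
      using Cons.IH sw by blast
    have "r = \<sigma> s \<cdot> (\<sigma> s \<cdot> r \<cdot> \<sigma> s) \<cdot> \<sigma> s" using r sw by (simp add: grp)
    also have "\<dots> = ev ((s # u) @ a # rev (s # u))"
      unfolding uv(2) using sw uv(1) by (simp add: ev_append grp)
    finally show ?thesis using uv(1) by (intro exI[of _ "s # u"] exI[of _ a] exI[of _ v]) auto
  qed
qed simp

text \<open>Multiplying by the reflection in a wall that the path \<open>w\<close> crosses deletes the letter of \<open>w\<close> at
  the crossing.\<close>

lemma exchange:
  assumes "set w \<subseteq> S" "r \<in> walls (ev w)"
  shows "\<exists>w'. set w' \<subseteq> S \<and> length w' < length w \<and> r \<cdot> ev w = ev w'"
proof -
  obtain u a v where w: "w = u @ a # v" "r = ev (u @ a # rev u)" using walls_ev[OF assms] by blast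
  have S: "set u \<subseteq> S" "a \<in> S" "set v \<subseteq> S" using assms w by auto
  have "ev (rev u) \<cdot> (ev u \<cdot> x) = x" if "x \<in> W" for x
    using that S cancel(1)[of "ev u" x] by (simp add: inv_ev)
  then have "r \<cdot> ev w = ev (u @ v)" using S by (simp add: w ev_append G.m_assoc)
  then show ?thesis using S w by (intro exI[of _ "u @ v"]) auto
qed

text \<open>If the wall of the first letter of a shortest word were not in \<open>walls g\<close>, it would be crossed
  again, and the word could be shortened.\<close>

lemma first_letter:
  assumes "g \<in> W" "g \<noteq> e"
  shows "\<exists>s\<in>S. \<sigma> s \<in> walls g"
proof -
  define n where "n = (LEAST n. \<exists>w. set w \<subseteq> S \<and> g = ev w \<and> length w = n)"
  have "\<exists>w. set w \<subseteq> S \<and> g = ev w \<and> length w = n" unfolding n_def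
    by (rule LeastI_ex) (use ev_surj[OF assms(1)] in blast)
  then obtain w where w: "set w \<subseteq> S" "g = ev w" "length w = n" by blast
  have min: "n \<le> length v" if "set v \<subseteq> S" "g = ev v" for v
    unfolding n_def by (rule Least_le) (use that in blast)
  obtain s u where su: "w = s # u" using w assms by (cases w) auto
  have "\<sigma> s \<notin> walls (ev u)"
  proof
    assume "\<sigma> s \<in> walls (ev u)"
    then obtain v where "set v \<subseteq> S" "length v < length u" "\<sigma> s \<cdot> ev u = ev v"
      using exchange[of u "\<sigma> s"] w su by auto
    then show False using min[of v] w su by auto
  qed
  then show ?thesis using su w gen_in_walls_gen_mult[of s "ev u"] by auto
qed

lemma walls_empty_iff: "g \<in> W \<Longrightarrow> walls g = {} \<longleftrightarrow> g = e"
  using first_letter by fastforce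

lemma len_0_iff: "g \<in> W \<Longrightarrow> len g = 0 \<longleftrightarrow> g = e"
  unfolding len_def using walls_empty_iff by simp

lemma descent_induct [consumes 1, case_names one mult]:
  assumes "g \<in> W" "P e"
    "\<And>s h. s \<in> S \<Longrightarrow> h \<in> W \<Longrightarrow> \<sigma> s \<notin> walls h \<Longrightarrow> P h \<Longrightarrow> P (\<sigma> s \<cdot> h)"
  shows "P g"
  using assms(1)
proof (induction "len g" arbitrary: g rule: less_induct)
  case less
  show ?case
  proof (cases "g = e")
    case False
    then obtain s where s: "s \<in> S" "\<sigma> s \<in> walls g" using first_letter less by blast
    have "P (\<sigma> s \<cdot> g)" using less len_gen_mult(1)[of s g] s by auto
    then show ?thesis
      using assms(3)[of s "\<sigma> s \<cdot> g"] gen_in_walls_gen_mult[of s g] s less by auto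
  qed (use assms in simp)
qed

lemma reflection_shortens:
  assumes "g \<in> W" "r \<in> walls g"
  shows "len (r \<cdot> g) < len g"
  using assms
proof (induction arbitrary: r rule: descent_induct)
  case (mult s h)
  have r: "r \<in> W" using mult walls_closed[of "\<sigma> s \<cdot> h"] by auto
  have lg: "len (\<sigma> s \<cdot> h) = Suc (len h)" using mult len_gen_mult by auto
  show ?case
  proof (cases "r = \<sigma> s")
    case False
    then have "\<sigma> s \<cdot> r \<cdot> \<sigma> s \<in> walls h" using mult walls_gen_mult r by auto
    then have "len (\<sigma> s \<cdot> r \<cdot> \<sigma> s \<cdot> h) < len h" using mult by auto
    moreover have "r \<cdot> (\<sigma> s \<cdot> h) = \<sigma> s \<cdot> (\<sigma> s \<cdot> r \<cdot> \<sigma> s \<cdot> h)"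
      using r mult by (simp add: grp)
    moreover have "len (\<sigma> s \<cdot> x) \<le> Suc (len x)" if "x \<in> W" for x
      using len_gen_mult[of s x] that mult(1) by (cases "\<sigma> s \<in> walls x") simp_all
    then have "len (\<sigma> s \<cdot> (\<sigma> s \<cdot> r \<cdot> \<sigma> s \<cdot> h)) \<le> Suc (len (\<sigma> s \<cdot> r \<cdot> \<sigma> s \<cdot> h))"
      using mult(1,2) r by simp
    ultimately show ?thesis using lg by simp
  qed (use mult lg in auto)
qed simp


section \<open>Non-adjacent generators\<close>

text \<open>The generators \<open>s\<close> and \<open>t\<close> act on the integer line as reflections in \<open>-1/2\<close> and \<open>1/2\<close>, and the
  others trivially.\<close>

definition line_reflection :: "'a \<Rightarrow> 'a \<Rightarrow> 'a \<Rightarrow> int \<Rightarrow> int" where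
  "line_reflection s t u z = (if u = s then - 1 - z else if u = t then 1 - z else z)"

lemma line_reflection_simps [simp]:
  "line_reflection s t s z = - 1 - z"
  "s \<noteq> t \<Longrightarrow> line_reflection s t t z = 1 - z"
  "u \<noteq> s \<Longrightarrow> u \<noteq> t \<Longrightarrow> line_reflection s t u z = z"
  by (simp_all add: line_reflection_def)

lemma line_reflections:
  assumes "s \<noteq> t" "\<not> adj s t"
  shows "racg_involutions \<Gamma> (line_reflection s t)"
  using assms adj_sym[of t s] unfolding racg_involutions_def line_reflection_def by auto

text \<open>Ping-pong with the negative and the positive integers.\<close>

lemma line_action_ev:
  assumes "s \<noteq> t" "\<not> adj s t" "s \<in> S" "t \<in> S" "set w \<subseteq> {s, t}" "distinct_adj w" "w \<noteq> []"
  shows "if hd w = s then racg_action (line_reflection s t) (ev w) 0 < 0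
    else racg_action (line_reflection s t) (ev w) 0 > 0"
  using assms(5-7)
proof (induction w)
  case (Cons u w)
  note inv = line_reflections[OF assms(1,2)]
  have w: "set w \<subseteq> S" using Cons.prems assms by auto
  have "racg_action (line_reflection s t) (ev (u # w)) 0 =
      line_reflection s t u (racg_action (line_reflection s t) (ev w) 0)"
    using Cons.prems w assms by (auto simp: racg_action_mult[OF inv] racg_action_gen[OF inv])
  moreover have "hd w \<noteq> u" if "w \<noteq> []"
    using Cons.prems that by (cases w) auto
  ultimately show ?case
    using Cons assms by (cases w) (auto simp: line_reflection_def racg_action_one[OF inv] split: if_splits)
qed simp

lemma ev_distinct_adj:
  assumes "set w \<subseteq> S"
  shows "\<exists>w'. set w' \<subseteq> set w \<and> distinct_adj w' \<and> ev w' = ev w"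
  using assms
proof (induction w)
  case (Cons s w)
  then obtain w' where w': "set w' \<subseteq> set w" "distinct_adj w'" "ev w' = ev w" by auto
  show ?case
  proof (cases "w' \<noteq> [] \<and> hd w' = s")
    case True
    then obtain v where "w' = s # v" by (cases w') auto
    moreover have "set v \<subseteq> S" using w' Cons.prems calculation by auto
    ultimately show ?thesis using w' Cons.prems
      by (intro exI[of _ v]) (auto simp: distinct_adj_Cons simp flip: w'(3))
  next
    case False
    then show ?thesis using w' by (intro exI[of _ "s # w'"]) (auto simp: distinct_adj_Cons)
  qed
qed (auto intro: exI[of _ "[]"])

text \<open>In the infinite dihedral group generated by \<open>s\<close> and \<open>t\<close>, an alternating word only crosses walls
  on one side of \<open>1\<close>: their reflections are alternating words with the same first letter.\<close>

lemma dihedral_walls: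
  assumes "s \<noteq> t" "\<not> adj s t" "s \<in> S" "t \<in> S" "set w \<subseteq> {s, t}"
    "\<sigma> s \<in> walls (ev w)" "\<sigma> t \<in> walls (ev w)"
  shows False
proof -
  obtain w' where w': "set w' \<subseteq> {s, t}" "distinct_adj w'" "ev w' = ev w"
    using ev_distinct_adj[of w] assms by (metis empty_subsetI insert_subset order_trans)
  have S: "set w' \<subseteq> S" using w' assms by auto
  have *: "hd w' = c" if "c \<in> {s, t}" "\<sigma> c \<in> walls (ev w')" for c
  proof -
    obtain u a v where uv: "w' = u @ a # v" "\<sigma> c = ev (u @ a # rev u)"
      using walls_ev[OF S] \<open>\<sigma> c \<in> walls (ev w')\<close> by blast
    have "distinct_adj (u @ [a])"
      using w'(2) unfolding uv(1) by (metis append.assoc append_Cons append_Nil distinct_adj_appendD1)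
    moreover from this have "distinct_adj (rev (u @ [a]))" by (simp only: distinct_adj_rev)
    then have "distinct_adj (a # rev u)" by (simp only: rev_append rev.simps append.simps)
    ultimately have d: "distinct_adj (u @ a # rev u)"
      by (auto simp: distinct_adj_append_iff)
    have "hd (u @ a # rev u) = hd w'" unfolding uv(1) by (cases u) auto
    moreover have "set (u @ a # rev u) \<subseteq> {s, t}" using w' unfolding uv(1) by auto
    ultimately have "if hd w' = s then racg_action (line_reflection s t) (\<sigma> c) 0 < 0
        else racg_action (line_reflection s t) (\<sigma> c) 0 > 0"
      using line_action_ev[OF assms(1-4) _ d] uv(2) by simp
    moreover have "hd w' \<in> {s, t}" using w'(1) unfolding uv(1) by (cases u) auto
    ultimately show ?thesis
      using that assms racg_action_gen[OF line_reflections[OF assms(1,2)]]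
      by (auto simp: line_reflection_def split: if_splits)
  qed
  show False using *[of s] *[of t] assms w' by auto
qed

text \<open>Call \<open>s\<close> a descent of \<open>g\<close> if its wall separates \<open>1\<close> from \<open>g\<close>, that is, if some reduced word for
  \<open>g\<close> starts with \<open>s\<close>. The walls of two non-adjacent generators are disjoint, so no \<open>g\<close> is behind both. Write
  \<open>g = d \<cdot> g'\<close> with \<open>d\<close> in the dihedral group of \<open>s\<close> and \<open>t\<close> and \<open>g'\<close> as short as possible. By
  \<open>reflection_shortens\<close> no reflection of the dihedral group is a wall of \<open>g'\<close>, so both walls would
  separate \<open>1\<close> from \<open>d\<close>.\<close>

lemma descents_adjacent:
  assumes g: "g \<in> W" and s: "s \<in> S" "\<sigma> s \<in> walls g" and t: "t \<in> S" "\<sigma> t \<in> walls g" and "s \<noteq> t"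
  shows "adj s t"
proof (rule ccontr)
  assume "\<not> adj s t"
  define D where "D = {ev w | w. set w \<subseteq> {s, t}}"
  have st: "{s, t} \<subseteq> S" using s t by auto
  have DW: "D \<subseteq> W" unfolding D_def using st by auto
  obtain d where d: "d \<in> D" and min: "\<And>c. c \<in> D \<Longrightarrow> len (iv d \<cdot> g) \<le> len (iv c \<cdot> g)"
  proof -
    have "e \<in> D" unfolding D_def by (auto intro!: exI[of _ "[]"])
    then show thesis
      using that ex_has_least_nat[of "\<lambda>d. d \<in> D" e "\<lambda>d. len (iv d \<cdot> g)"] by blast
  qed
  have dW: "d \<in> W" using d DW by auto
  have conj: "iv d \<cdot> \<sigma> c \<cdot> d \<notin> walls (iv d \<cdot> g)" if c: "c \<in> {s, t}" for c
  proof
    assume "iv d \<cdot> \<sigma> c \<cdot> d \<in> walls (iv d \<cdot> g)"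
    from reflection_shortens[OF _ this] have "len (iv d \<cdot> \<sigma> c \<cdot> d \<cdot> (iv d \<cdot> g)) < len (iv d \<cdot> g)"
      using dW g by simp
    moreover have "iv d \<cdot> \<sigma> c \<cdot> d \<cdot> (iv d \<cdot> g) = iv (\<sigma> c \<cdot> d) \<cdot> g"
      using dW g c st by (auto simp: grp)
    moreover have "\<sigma> c \<cdot> d \<in> D"
    proof -
      obtain w where "set w \<subseteq> {s, t}" "d = ev w" using d unfolding D_def by auto
      then show ?thesis unfolding D_def using c by (auto intro!: exI[of _ "c # w"])
    qed
    ultimately show False using min by fastforce
  qed
  have "\<sigma> c \<in> walls d" if "c \<in> {s, t}" for c
    using conj[OF that] walls_translate[of d g "\<sigma> c"] that dW g s t by auto
  then show False
    using dihedral_walls[of s t] \<open>s \<noteq> t\<close> \<open>\<not> adj s t\<close> d s t unfolding D_def by auto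
qed

section \<open>Meets\<close>

lemma walls_cancel_subset:
  assumes "s \<in> S" "g \<in> W" "h \<in> W" "\<sigma> s \<in> walls g" "\<sigma> s \<in> walls h" "walls g \<subseteq> walls h"
  shows "walls (\<sigma> s \<cdot> g) \<subseteq> walls (\<sigma> s \<cdot> h)"
proof
  fix r assume r: "r \<in> walls (\<sigma> s \<cdot> g)"
  then have "r \<in> W" using walls_closed[of "\<sigma> s \<cdot> g"] assms by auto
  then show "r \<in> walls (\<sigma> s \<cdot> h)"
    using r assms gen_in_walls_gen_mult[of s g] by (cases "r = \<sigma> s") (auto simp: walls_gen_mult)
qed

text \<open>Induction on \<open>x\<close>. If the first letter \<open>s\<close> of \<open>x\<close> is not a descent of \<open>g\<close>, strip it from \<open>x\<close> and put it in
  front of \<open>g\<close>. The common descent \<open>t\<close> of the new pair is adjacent to \<open>s\<close>, since both are descents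
  of \<open>\<sigma> s \<cdot> g\<close>. So its wall is not moved by \<open>s\<close>, and \<open>t\<close> is a descent of the old pair.\<close>

lemma common_descent:
  assumes "x \<in> W" "g \<in> W" "r \<in> walls x" "r \<in> walls g"
  shows "\<exists>s\<in>S. \<sigma> s \<in> walls x \<and> \<sigma> s \<in> walls g"
  using assms
proof (induction arbitrary: g r rule: descent_induct)
  case (mult s x)
  note s = \<open>s \<in> S\<close> and x = \<open>x \<in> W\<close> and g = \<open>g \<in> W\<close>
  have sx: "\<sigma> s \<in> walls (\<sigma> s \<cdot> x)" using mult gen_in_walls_gen_mult by auto
  show ?case
  proof (cases "\<sigma> s \<in> walls g")
    case False
    then have "r \<noteq> \<sigma> s" using mult by auto
    have r: "r \<in> W" using walls_closed[OF g] mult by auto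
    have "\<sigma> s \<cdot> r \<cdot> \<sigma> s \<in> walls x" using mult walls_gen_mult[OF s x r] \<open>r \<noteq> \<sigma> s\<close> by auto
    moreover have "\<sigma> s \<cdot> r \<cdot> \<sigma> s \<in> walls (\<sigma> s \<cdot> g)"
    proof -
      have "\<sigma> s \<cdot> (\<sigma> s \<cdot> r \<cdot> \<sigma> s) \<cdot> \<sigma> s = r" using r s by (simp add: grp)
      then show ?thesis
        using walls_gen_mult[of s g "\<sigma> s \<cdot> r \<cdot> \<sigma> s"] mult r \<open>r \<noteq> \<sigma> s\<close> conj_eq_gen_iff[OF s r] by auto
    qed
    ultimately obtain t where t: "t \<in> S" "\<sigma> t \<in> walls x" "\<sigma> t \<in> walls (\<sigma> s \<cdot> g)"
      using mult.IH s g by blast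
    have st: "s \<noteq> t" using t mult by auto
    have "\<sigma> s \<in> walls (\<sigma> s \<cdot> g)" using gen_in_walls_gen_mult[OF s g] False by auto
    then have adj: "adj s t" using descents_adjacent[of "\<sigma> s \<cdot> g" s t] s t g st by auto
    have "\<sigma> s \<cdot> \<sigma> t \<cdot> \<sigma> s = \<sigma> t"
      using gen_commute[OF adj] gen_commute'[OF adj, of "\<sigma> s"] s t by (simp add: grp)
    moreover have "\<sigma> t \<noteq> \<sigma> s" using t mult by auto
    ultimately show ?thesis
      using t walls_gen_mult[OF s x, of "\<sigma> t"] walls_gen_mult[OF s g, of "\<sigma> t"] by auto
  qed (use sx s in auto)
qed simp

text \<open>The group is a meet semilattice in the weak order: split off common descents until, by
  \<open>common_descent\<close>, no common wall is left.\<close>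

lemma ex_meet:
  assumes "x \<in> W" "g \<in> W"
  shows "\<exists>p\<in>W. walls p = walls x \<inter> walls g"
  using assms
proof (induction "len x" arbitrary: x g rule: less_induct)
  case less
  show ?case
  proof (cases "walls x \<inter> walls g = {}")
    case True
    then show ?thesis by (intro bexI[of _ e]) auto
  next
    case False
    then obtain s where s: "s \<in> S" "\<sigma> s \<in> walls x" "\<sigma> s \<in> walls g"
      using common_descent less.prems by blast
    obtain p where p: "p \<in> W" "walls p = walls (\<sigma> s \<cdot> x) \<inter> walls (\<sigma> s \<cdot> g)"
      using less.hyps[of "\<sigma> s \<cdot> x" "\<sigma> s \<cdot> g"] less.prems s len_gen_mult(1)[of s x] by auto
    have sp: "\<sigma> s \<notin> walls p" using p s gen_in_walls_gen_mult less.prems by auto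
    have "walls (\<sigma> s \<cdot> p) = walls x \<inter> walls g"
    proof (rule Set.set_eqI)
      fix r
      show "r \<in> walls (\<sigma> s \<cdot> p) \<longleftrightarrow> r \<in> walls x \<inter> walls g"
      proof (cases "r \<in> W")
        case r: True
        have "r \<in> walls (\<sigma> s \<cdot> y) \<longleftrightarrow> (r = \<sigma> s \<or> \<sigma> s \<cdot> r \<cdot> \<sigma> s \<in> walls y)"
          if "y \<in> W" "\<sigma> s \<notin> walls y" for y
          using walls_gen_mult[OF s(1) that(1) r] that conj_eq_gen_iff[OF s(1) r] by auto
        from this[of p] this[of "\<sigma> s \<cdot> x"] this[of "\<sigma> s \<cdot> g"] show ?thesis
          using p sp s less.prems gen_in_walls_gen_mult by auto
      next
        case False
        then show ?thesis using walls_closed[of "\<sigma> s \<cdot> p"] walls_closed[of x] p s less.prems by auto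
      qed
    qed
    then show ?thesis using p s by (intro bexI[of _ "\<sigma> s \<cdot> p"]) auto
  qed
qed

text \<open>Let \<open>m\<close> be the meet of \<open>x\<close> and \<open>y\<close>. A descent \<open>u\<close> of \<open>m\<close> is a descent of \<open>x\<close>, together with \<open>s\<close>, and
  of \<open>y\<close>, together with \<open>t\<close>, so it is adjacent to both \<open>s\<close> and \<open>t\<close>. Stripping \<open>u\<close> from all three
  elements does not affect the hypotheses, so that a second letter of \<open>m\<close> would be another common
  neighbour.\<close>

lemma card_common_walls:
  assumes x: "x \<in> W" and y: "y \<in> W" and s: "s \<in> S" "\<sigma> s \<in> walls x" and t: "t \<in> S" "\<sigma> t \<in> walls y"
    and st: "s \<noteq> t" "\<not> adj s t"
    and link: "\<And>u v. \<lbrakk>adj s u; adj t u; adj s v; adj t v\<rbrakk> \<Longrightarrow> u = v"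
  shows "card (walls x \<inter> walls y) \<le> 1"
proof -
  obtain m where m: "m \<in> W" "walls m = walls x \<inter> walls y" using ex_meet x y by blast
  have first: "adj s u \<and> adj t u"
    if "a \<in> W" "b \<in> W" "\<sigma> s \<in> walls a" "\<sigma> t \<in> walls b" "u \<in> S" "\<sigma> u \<in> walls a" "\<sigma> u \<in> walls b"
    for a b u
    using that s t st descents_adjacent[of a s u] descents_adjacent[of b t u]
      descents_adjacent[of b s t] descents_adjacent[of a s t] by blast
  show ?thesis
  proof (cases "m = e")
    case False
    then obtain u where u: "u \<in> S" "\<sigma> u \<in> walls m" using first_letter m by blast
    have su: "adj s u" "adj t u" using first[OF x y s(2) t(2)] u m by auto
    have "\<sigma> u \<cdot> m = e"
    proof (rule ccontr)
      assume "\<sigma> u \<cdot> m \<noteq> e"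
      then obtain v where v: "v \<in> S" "\<sigma> v \<in> walls (\<sigma> u \<cdot> m)" using first_letter m u by blast
      have comm: "\<sigma> c \<in> walls (\<sigma> u \<cdot> z)" if "adj c u" "\<sigma> c \<in> walls z" "z \<in> W" for c z
      proof -
        have "\<sigma> u \<cdot> \<sigma> c \<cdot> \<sigma> u = \<sigma> c"
          using gen_commute[OF \<open>adj c u\<close>] adj_verts[OF \<open>adj c u\<close>] by (simp add: grp flip: gen_commute[OF \<open>adj c u\<close>])
        moreover have "\<sigma> c \<noteq> \<sigma> u"
          using that adj_verts[of c u] adj_irrefl gen_eq_iff by blast
        ultimately show ?thesis using that u adj_verts[of c u] walls_gen_mult[of u z "\<sigma> c"] by auto
      qed
      have "walls (\<sigma> u \<cdot> m) \<subseteq> walls (\<sigma> u \<cdot> x)" "walls (\<sigma> u \<cdot> m) \<subseteq> walls (\<sigma> u \<cdot> y)"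
        using walls_cancel_subset[of u m] u m x y by auto
      then have "adj s v \<and> adj t v"
        using first[of "\<sigma> u \<cdot> x" "\<sigma> u \<cdot> y" v] comm su x y s t u v by auto
      then have "u = v" using link su by blast
      then show False using v u m gen_in_walls_gen_mult[of u m] by auto
    qed
    then have "m = \<sigma> u" using gen_mult_eq_one_iff u m by auto
    then show ?thesis using m u by (simp flip: m(2))
  qed (use m in \<open>simp flip: m(2)\<close>)
qed


section \<open>Special subgroups\<close>

abbreviation special where "special U \<equiv> generate (racg \<Gamma>) (\<sigma> ` U)"

lemma special_subgroup: "U \<subseteq> S \<Longrightarrow> subgroup (special U) (racg \<Gamma>)"
  by (intro G.generate_is_subgroup) auto

lemma special_closed: "U \<subseteq> S \<Longrightarrow> g \<in> special U \<Longrightarrow> g \<in> W"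
  by (rule subgroup.mem_carrier[OF special_subgroup])

lemma walls_special:
  assumes "U \<subseteq> S" "g \<in> special U"
  shows "walls g \<subseteq> special U"
proof
  fix r assume "r \<in> walls g"
  moreover obtain w where w: "set w \<subseteq> U" "g = ev w" using assms generate_ev by auto
  moreover have "set w \<subseteq> S" using w assms by auto
  ultimately obtain u a v where "w = u @ a # v" "r = ev (u @ a # rev u)" using walls_ev by blast
  then show "r \<in> special U"
    unfolding generate_ev[OF assms(1)] using w by (auto intro!: exI[of _ "u @ a # rev u"])
qed

lemma special_descent:
  assumes "U \<subseteq> S" "g \<in> special U" "s \<in> S" "\<sigma> s \<in> walls g"
  shows "s \<in> U"
  using gen_notin_subgroup[of s U] walls_special[of U g] assms by blast

text \<open>The first letter of \<open>p\<close> is a descent of \<open>g\<close>, hence in \<open>U\<close>; strip it from both.\<close>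

lemma special_convex:
  assumes U: "U \<subseteq> S" and "p \<in> W" "g \<in> special U" "walls p \<subseteq> walls g"
  shows "p \<in> special U"
  using assms(2-)
proof (induction arbitrary: g rule: descent_induct)
  case (mult s h)
  interpret K: subgroup "special U" "racg \<Gamma>" by (rule special_subgroup[OF U])
  have g: "g \<in> W" using special_closed[OF U] mult by auto
  have sp: "\<sigma> s \<in> walls (\<sigma> s \<cdot> h)" using mult gen_in_walls_gen_mult by auto
  then have sg: "\<sigma> s \<in> walls g" using mult by auto
  then have s: "\<sigma> s \<in> special U"
    using special_descent[OF U] mult by (auto intro: generate.incl)
  have "walls h \<subseteq> walls (\<sigma> s \<cdot> g)"
    using walls_cancel_subset[of s "\<sigma> s \<cdot> h" g] mult g sg sp by auto
  then have "h \<in> special U" using mult.IH[of "\<sigma> s \<cdot> g"] mult s by auto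
  then show ?case using s by auto
qed (simp add: generate.one)

text \<open>Among the first three letters \<open>a, b, c\<close> of a reduced word, one of the pairs \<open>a, b\<close> and \<open>b, c\<close> is
  non-adjacent, or else \<open>a\<close> and \<open>c\<close> are distinct, as the word is reduced, and non-adjacent, as there
  are no triangles; in this case \<open>a\<close> can be moved next to \<open>c\<close>. The word is cut between the two letters found.\<close>

lemma ex_corner:
  assumes "triangle_free \<Gamma>" and U: "U \<subseteq> S" and k: "k \<in> special U" "3 \<le> len k"
  obtains k1 k2 s t where "k1 \<in> W" "k2 \<in> W" "k = k1 \<cdot> k2" "len k = len k1 + len k2"
    "s \<in> U" "t \<in> U" "s \<noteq> t" "\<not> adj s t" "\<sigma> s \<in> walls (iv k1)" "\<sigma> t \<in> walls k2"
proof -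
  interpret K: subgroup "special U" "racg \<Gamma>" by (rule special_subgroup[OF U])
  have strip: "\<exists>s\<in>U. \<sigma> s \<in> walls h \<and> \<sigma> s \<notin> walls (\<sigma> s \<cdot> h) \<and> \<sigma> s \<cdot> h \<in> special U \<and>
      len h = Suc (len (\<sigma> s \<cdot> h))" if h: "h \<in> special U" "len h > 0" for h
  proof -
    have hW: "h \<in> W" using special_closed[OF U] h by auto
    then have "h \<noteq> e" using h len_0_iff[of h] by auto
    then obtain s where s: "s \<in> S" "\<sigma> s \<in> walls h" using first_letter hW by blast
    then have "s \<in> U" using special_descent[OF U h(1)] by blast
    then show ?thesis
      using s h hW gen_in_walls_gen_mult[of s h] len_gen_mult(1)[of s h] generate.incl[of "\<sigma> s" "\<sigma> ` U"]
      by (intro bexI[of _ s]) auto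
  qed
  obtain a where a: "a \<in> U" "\<sigma> a \<in> walls k" "\<sigma> a \<cdot> k \<in> special U" "len k = Suc (len (\<sigma> a \<cdot> k))"
      "\<sigma> a \<notin> walls (\<sigma> a \<cdot> k)"
    using strip[of k] k by auto
  define k' where "k' = \<sigma> a \<cdot> k"
  obtain b where b: "b \<in> U" "\<sigma> b \<in> walls k'" "\<sigma> b \<cdot> k' \<in> special U" "len k' = Suc (len (\<sigma> b \<cdot> k'))"
      "\<sigma> b \<notin> walls (\<sigma> b \<cdot> k')"
    using strip[of k'] k a unfolding k'_def by auto
  define k'' where "k'' = \<sigma> b \<cdot> k'"
  obtain c where c: "c \<in> U" "\<sigma> c \<in> walls k''"
    using strip[of k''] k a b unfolding k'_def k''_def by auto
  have S: "a \<in> S" "b \<in> S" "c \<in> S" using a b c U by auto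
  have W: "k \<in> W" "k' \<in> W" "k'' \<in> W" using special_closed[OF U] k a b unfolding k'_def k''_def by auto
  have ab: "a \<noteq> b" using a b unfolding k'_def by auto
  have bc: "b \<noteq> c" using b c unfolding k''_def by auto
  have kk: "k = \<sigma> a \<cdot> k'" "k' = \<sigma> b \<cdot> k''" unfolding k'_def k''_def using W S by auto
  have len1: "len (\<sigma> s) = 1" if "s \<in> S" for s using that by (simp add: len_def)
  have ba: "\<sigma> b \<notin> walls (\<sigma> a)" using S ab gen_eq_iff by simp
  have len2: "len (\<sigma> a \<cdot> \<sigma> b) = 2"
    using len_gen_mult(2)[of a "\<sigma> b"] S ab gen_eq_iff len1 by simp
  have len: "len k = Suc (len k')" "len k' = Suc (len k'')" using a b unfolding k'_def k''_def by auto
  have split: "k = \<sigma> a \<cdot> \<sigma> b \<cdot> k''" "len k = len (\<sigma> a \<cdot> \<sigma> b) + len k''"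
    using kk S W len len2 by (auto simp: grp)
  show thesis
  proof (cases "adj a b")
    case False
    then show thesis
      using that[of "\<sigma> a" k' a b] a b kk S W ab len len1 by auto
  next
    case ab_adj: True
    show thesis
    proof (cases "adj b c")
      case False
      have "\<sigma> b \<in> walls (iv (\<sigma> a \<cdot> \<sigma> b))"
        using S ba gen_in_walls_gen_mult[of b "\<sigma> a"] by (simp add: grp)
      then show thesis
        using that[of "\<sigma> a \<cdot> \<sigma> b" k'' b c] split False bc S W b c by auto
    next
      case True
      have "a \<noteq> c"
      proof
        assume "a = c"
        have "\<sigma> b \<cdot> \<sigma> a \<cdot> \<sigma> b = \<sigma> a"
          using gen_commute[OF ab_adj] S by (simp add: grp flip: gen_commute[OF ab_adj])
        then have "\<sigma> a \<in> walls k'"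
          using walls_gen_mult[of b k'' "\<sigma> a"] kk S W c \<open>a = c\<close> ab gen_eq_iff by auto
        then show False using a unfolding k'_def by auto
      qed
      moreover have "\<not> adj a c"
        using assms(1) ab_adj True adj_sym unfolding triangle_free_def by blast
      moreover have "\<sigma> a \<in> walls (iv (\<sigma> a \<cdot> \<sigma> b))"
        using S ab gen_eq_iff gen_in_walls_gen_mult[of a "\<sigma> b"] gen_commute[OF ab_adj]
        by (simp add: grp)
      ultimately show thesis
        using that[of "\<sigma> a \<cdot> \<sigma> b" k'' a c] split S W a c by auto
    qed
  qed
qed

section \<open>Word distance by counting walls\<close>

lemma wdist_sym: "x \<in> W \<Longrightarrow> y \<in> W \<Longrightarrow> wdist x y = wdist y x"
  by (simp add: wdist_walls Un_commute)

lemma wdist_translate: "v \<in> W \<Longrightarrow> x \<in> W \<Longrightarrow> y \<in> W \<Longrightarrow> wdist (v \<cdot> x) (v \<cdot> y) = wdist x y"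
  by (simp add: wdist_def grp)

lemma card_sym_diff:
  assumes "finite A" "finite B"
  shows "card (sym_diff A B) = card (A - B) + card (B - A)"
  using assms by (intro card_Un_disjoint) auto

lemma wdist_triangle:
  assumes "x \<in> W" "y \<in> W" "z \<in> W"
  shows "wdist x z \<le> wdist x y + wdist y z"
proof -
  have "card (sym_diff (walls x) (walls z)) \<le> card (sym_diff (walls x) (walls y) \<union> sym_diff (walls y) (walls z))"
    using assms by (intro card_mono) auto
  also have "\<dots> \<le> card (sym_diff (walls x) (walls y)) + card (sym_diff (walls y) (walls z))"
    by (rule card_Un_le)
  finally show ?thesis using assms by (simp only: wdist_walls)
qed

text \<open>A geodesic crosses no wall twice.\<close>

lemma geodesic_between:
  assumes "x \<in> W" "v \<in> W" "y \<in> W" "wdist x y = wdist x v + wdist v y"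
  shows "walls x \<inter> walls y \<subseteq> walls v" "walls v \<subseteq> walls x \<union> walls y"
proof -
  let ?A = "sym_diff (walls x) (walls v)" and ?B = "sym_diff (walls v) (walls y)"
  have fin: "finite ?A" "finite ?B" using assms by auto
  have "card (sym_diff (walls x) (walls y)) \<le> card ((?A \<union> ?B) - (?A \<inter> ?B))"
    using fin by (intro card_mono) auto
  also have "\<dots> = card (?A \<union> ?B) - card (?A \<inter> ?B)"
    using fin by (intro card_Diff_subset) auto
  finally have "card ?A + card ?B \<le> card (?A \<union> ?B) - card (?A \<inter> ?B)"
    using assms by (simp only: wdist_walls)
  moreover have "card (?A \<union> ?B) + card (?A \<inter> ?B) = card ?A + card ?B"
    using card_Un_Int[OF fin] by simp
  ultimately have "card (?A \<inter> ?B) = 0" by linarith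
  then have "?A \<inter> ?B = {}" using fin by (simp only: card_0_eq finite_Int simp_thms)
  then show "walls x \<inter> walls y \<subseteq> walls v" "walls v \<subseteq> walls x \<union> walls y" by blast+
qed

section \<open>Bottlenecks in special subgroups\<close>

text \<open>In a triangle-free graph, two common neighbours of \<open>s\<close> and \<open>t\<close> are not adjacent. So this says that
  no two non-adjacent vertices in \<open>U\<close> lie on an induced four-cycle.\<close>

definition thin_links :: "'a set \<Rightarrow> bool" where
  "thin_links U \<longleftrightarrow> (\<forall>s\<in>U. \<forall>t\<in>U. s \<noteq> t \<longrightarrow> \<not> adj s t \<longrightarrow>
     (\<forall>u v. adj s u \<longrightarrow> adj t u \<longrightarrow> adj s v \<longrightarrow> adj t v \<longrightarrow> u = v))"

text \<open>A geodesic from \<open>p\<close> to \<open>q\<close> crosses \<open>r\<^sub>1\<close> just before and \<open>r\<^sub>2\<close> just after a corner \<open>v\<close>. Whenever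
  \<open>x\<close> is on the side of \<open>p\<close> of the first and \<open>y\<close> is on the side of \<open>q\<close> of the second, the distance
  from \<open>x\<close> to \<open>y\<close> is nearly realised through \<open>v\<close>: this is \<open>card_common_walls\<close>, translated to \<open>v\<close>.
  While \<open>p\<close> and \<open>q\<close> differ by an element of the special subgroup, \<open>x\<close> and \<open>y\<close> range over the whole
  group.\<close>

lemma ex_bottleneck:
  assumes "triangle_free \<Gamma>" and U: "U \<subseteq> S" "thin_links U"
    and pq: "p \<in> W" "q \<in> W" "iv p \<cdot> q \<in> special U" "3 \<le> wdist p q"
  obtains v r\<^sub>1 r\<^sub>2 where "v \<in> W" "walls p \<inter> walls q \<subseteq> walls v" "walls v \<subseteq> walls p \<union> walls q"
    "r\<^sub>1 \<in> sym_diff (walls p) (walls q)" "r\<^sub>2 \<in> sym_diff (walls p) (walls q)"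
    "\<forall>x\<in>W. \<forall>y\<in>W. (r\<^sub>1 \<in> walls x \<longleftrightarrow> r\<^sub>1 \<in> walls p) \<longrightarrow> (r\<^sub>2 \<in> walls y \<longleftrightarrow> r\<^sub>2 \<in> walls q) \<longrightarrow>
      wdist x v + wdist v y \<le> wdist x y + 2"
proof -
  obtain k1 k2 s t where k: "k1 \<in> W" "k2 \<in> W" "iv p \<cdot> q = k1 \<cdot> k2" "len (iv p \<cdot> q) = len k1 + len k2"
    and st: "s \<in> U" "t \<in> U" "s \<noteq> t" "\<not> adj s t" "\<sigma> s \<in> walls (iv k1)" "\<sigma> t \<in> walls k2"
    using ex_corner[OF assms(1) U(1) pq(3)] pq(4) unfolding wdist_def by metis
  have S: "s \<in> S" "t \<in> S" using st U by auto
  define v where "v = p \<cdot> k1"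
  have v: "v \<in> W" unfolding v_def using pq k by simp
  have vp: "iv v \<cdot> p = iv k1" unfolding v_def using pq k by (simp add: grp)
  have "q = p \<cdot> (iv p \<cdot> q)" using pq by simp
  then have q: "q = p \<cdot> k1 \<cdot> k2" using pq(1) k(1,2) by (simp add: k(3) G.m_assoc)
  have vq: "iv v \<cdot> q = k2" unfolding v_def q using pq k by (simp add: grp)
  have "wdist p q = wdist p v + wdist v q"
    using k pq vq unfolding wdist_def by (simp add: v_def)
  note between = geodesic_between[OF pq(1) v pq(2) this]
  have t: "\<sigma> t \<notin> walls (iv k1)" and s: "\<sigma> s \<notin> walls k2"
    using descents_adjacent[of "iv k1" s t] descents_adjacent[of k2 s t] st S k by auto
  define r where "r c = v \<cdot> \<sigma> c \<cdot> iv v" for c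
  have r: "\<sigma> c \<in> walls (iv v \<cdot> x) \<longleftrightarrow> (r c \<in> walls v) \<noteq> (r c \<in> walls x)" if "c \<in> S" "x \<in> W" for c x
  proof -
    have "iv v \<cdot> r c \<cdot> v = \<sigma> c" unfolding r_def using v that by (simp add: grp)
    then show ?thesis using walls_translate[OF v that(2), of "r c"] v that unfolding r_def by simp
  qed
  have rpq: "r s \<in> walls v \<longleftrightarrow> r s \<notin> walls p" "r s \<in> walls v \<longleftrightarrow> r s \<in> walls q"
    "r t \<in> walls v \<longleftrightarrow> r t \<notin> walls q" "r t \<in> walls v \<longleftrightarrow> r t \<in> walls p"
    using r[of s p] r[of s q] r[of t p] r[of t q] vp vq s t st S pq by auto
  have far: "wdist x v + wdist v y \<le> wdist x y + 2"
    if xy: "x \<in> W" "y \<in> W" "r s \<in> walls x \<longleftrightarrow> r s \<in> walls p" "r t \<in> walls y \<longleftrightarrow> r t \<in> walls q" for x y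
  proof -
    let ?x = "iv v \<cdot> x" and ?y = "iv v \<cdot> y"
    have W: "?x \<in> W" "?y \<in> W" using xy v by auto
    have in_walls: "\<sigma> s \<in> walls ?x" "\<sigma> t \<in> walls ?y" using r S xy rpq by auto
    have "u = w" if "adj s u" "adj t u" "adj s w" "adj t w" for u w
      using U(2) st(1-4) that unfolding thin_links_def by blast
    then have common: "card (walls ?x \<inter> walls ?y) \<le> 1"
      by (rule card_common_walls[OF W S(1) in_walls(1) S(2) in_walls(2) st(3,4)])
    have "card (walls ?x) = card (walls ?x \<inter> walls ?y) + card (walls ?x - walls ?y)"
      using W by (intro card_Int_Diff) simp
    moreover have "card (walls ?y) = card (walls ?x \<inter> walls ?y) + card (walls ?y - walls ?x)"
      using W card_Int_Diff[of "walls ?y" "walls ?x"] by (simp add: Int_commute)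
    moreover have "wdist ?x ?y = card (walls ?x - walls ?y) + card (walls ?y - walls ?x)"
      using W by (simp only: wdist_walls card_sym_diff finite_walls)
    moreover have "wdist x v = card (walls ?x)" "wdist v y = card (walls ?y)"
      using wdist_sym[of x v] xy v unfolding wdist_def len_def by auto
    moreover have "wdist ?x ?y = wdist x y" using wdist_translate xy v by simp
    ultimately show ?thesis using common by linarith
  qed
  show thesis
    using that[of v "r s" "r t"] v between far rpq by blast
qed

section \<open>Projection to an interval of a special subgroup\<close>

text \<open>The gate is the point closest to \<open>x\<close> in the interval between \<open>1\<close> and \<open>g\<close>, which consists of the
  \<open>p\<close> with \<open>walls p \<subseteq> walls g\<close>.\<close>

definition gate :: "'a word set \<Rightarrow> 'a word set \<Rightarrow> 'a word set" where
  "gate g x = (SOME p. p \<in> W \<and> walls p = walls x \<inter> walls g)"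

lemma gate:
  assumes "g \<in> W" "x \<in> W"
  shows "gate g x \<in> W" "walls (gate g x) = walls x \<inter> walls g"
  using someI_ex[of "\<lambda>p. p \<in> W \<and> walls p = walls x \<inter> walls g"] ex_meet[OF assms(2,1)]
  unfolding gate_def by auto

text \<open>The distance of \<open>x\<close> to the interval, see \<open>wdist_gate\<close>.\<close>

definition depth :: "'a word set \<Rightarrow> 'a word set \<Rightarrow> nat" where
  "depth g x = card (walls x - walls g)"

text \<open>The distance of the gate of \<open>x\<close> to \<open>1\<close>.\<close>

definition height :: "'a word set \<Rightarrow> 'a word set \<Rightarrow> nat" where
  "height g x = card (walls x \<inter> walls g)"

lemma wdist_gate:
  assumes "g \<in> W" "x \<in> W"
  shows "wdist x (gate g x) = depth g x"
proof -
  have "sym_diff (walls x) (walls (gate g x)) = walls x - walls g" using gate[OF assms] by auto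
  then show ?thesis using gate[OF assms] assms unfolding depth_def by (simp only: wdist_walls)
qed

text \<open>A wall that separates the gates is one of \<open>walls g\<close>, so it separates \<open>x\<close> and \<open>y\<close> in the same way.
  A bottleneck \<open>v\<close> between the gates is thus one for \<open>x\<close> and \<open>y\<close>, and \<open>v\<close> lies in the
  interval, so that its distances to \<open>x\<close> and \<open>y\<close> are at least their depths.\<close>

lemma contraction:
  assumes "triangle_free \<Gamma>" and U: "U \<subseteq> S" "thin_links U" and g: "g \<in> special U"
    and xy: "x \<in> W" "y \<in> W" and far: "2 < wdist (gate g x) (gate g y)"
  shows "depth g x + depth g y \<le> wdist x y + 2"
proof -
  interpret K: subgroup "special U" "racg \<Gamma>" by (rule special_subgroup[OF U(1)])
  have gW: "g \<in> W" using special_closed U g by auto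
  let ?p = "gate g x" and ?q = "gate g y"
  note p = gate[OF gW xy(1)] and q = gate[OF gW xy(2)]
  have "?p \<in> special U" "?q \<in> special U" using special_convex[OF U(1) _ g] p q by auto
  then have "iv ?p \<cdot> ?q \<in> special U" by auto
  moreover have "3 \<le> wdist ?p ?q" using far by simp
  ultimately obtain v r\<^sub>1 r\<^sub>2 where v: "v \<in> W" "walls v \<subseteq> walls ?p \<union> walls ?q"
    and r: "r\<^sub>1 \<in> sym_diff (walls ?p) (walls ?q)" "r\<^sub>2 \<in> sym_diff (walls ?p) (walls ?q)"
    and sep: "\<forall>x\<in>W. \<forall>y\<in>W. (r\<^sub>1 \<in> walls x \<longleftrightarrow> r\<^sub>1 \<in> walls ?p) \<longrightarrow> (r\<^sub>2 \<in> walls y \<longleftrightarrow> r\<^sub>2 \<in> walls ?q) \<longrightarrow>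
      wdist x v + wdist v y \<le> wdist x y + 2"
    by (rule ex_bottleneck[OF assms(1) U p(1) q(1)]) (rule that)
  have "wdist x v + wdist v y \<le> wdist x y + 2"
    using sep[rule_format, OF xy] r p q by auto
  moreover have "depth g z \<le> wdist z v" if "z \<in> W" for z
    unfolding depth_def wdist_walls[OF that v(1)]
    using v p q that by (intro card_mono) auto
  from this[OF xy(1)] this[OF xy(2)] have "depth g x \<le> wdist x v" "depth g y \<le> wdist v y"
    using wdist_sym[OF xy(2) v(1)] by simp_all
  ultimately show ?thesis by linarith
qed

text \<open>Intervals are thin. Suppose that \<open>p\<close> has three walls that \<open>q\<close> does not have. As \<open>q\<close> is not shorter
  than \<open>p\<close>, there are also three walls between the meet \<open>m\<close> of \<open>p\<close> and \<open>q\<close> and \<open>q\<close>, hence a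
  bottleneck \<open>v\<close>. Now \<open>p\<close> is on the side of \<open>m\<close> and \<open>g\<close> is on the side of \<open>q\<close>, so the geodesics
  from \<open>p\<close> to \<open>g\<close> pass near \<open>v\<close>, and \<open>p\<close> has at most one wall that \<open>v\<close> does not have. But the
  walls of \<open>v\<close> are among those of \<open>q\<close>.\<close>

lemma interval_thin:
  assumes "triangle_free \<Gamma>" and U: "U \<subseteq> S" "thin_links U" and g: "g \<in> special U"
    and pq: "p \<in> W" "q \<in> W" "walls p \<subseteq> walls g" "walls q \<subseteq> walls g" and le: "len p \<le> len q"
  shows "wdist p q \<le> len q - len p + 4"
proof -
  interpret K: subgroup "special U" "racg \<Gamma>" by (rule special_subgroup[OF U(1)])
  have gW: "g \<in> W" using special_closed U g by auto
  have fin: "finite (walls p)" "finite (walls q)" "finite (walls g)" using pq gW by auto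
  have pc: "card (walls p) = card (walls p \<inter> walls q) + card (walls p - walls q)"
    using fin by (intro card_Int_Diff)
  have qc: "card (walls q) = card (walls p \<inter> walls q) + card (walls q - walls p)"
    using fin card_Int_Diff[of "walls q" "walls p"] by (simp add: Int_commute)
  have d: "wdist p q = card (walls p - walls q) + card (walls q - walls p)"
    using pq by (simp only: wdist_walls card_sym_diff finite_walls)
  have "card (walls p - walls q) \<le> 2"
  proof (rule ccontr)
    assume "\<not> card (walls p - walls q) \<le> 2"
    then have big: "3 \<le> card (walls q - walls p)" using pc qc le unfolding len_def by linarith
    obtain m where m: "m \<in> W" "walls m = walls p \<inter> walls q" using ex_meet[OF pq(1,2)] by blast
    have mK: "m \<in> special U" "q \<in> special U" using special_convex[OF U(1) _ g] m pq by auto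
    have "wdist m q = card (walls q - walls p)"
    proof -
      have "sym_diff (walls m) (walls q) = walls q - walls p" using m by auto
      then show ?thesis using m pq by (simp only: wdist_walls)
    qed
    then have far: "3 \<le> wdist m q" using big by simp
    have "iv m \<cdot> q \<in> special U" using mK by auto
    from this far obtain v r\<^sub>1 r\<^sub>2 where v: "v \<in> W" "walls m \<inter> walls q \<subseteq> walls v" "walls v \<subseteq> walls m \<union> walls q"
      and r: "r\<^sub>1 \<in> sym_diff (walls m) (walls q)" "r\<^sub>2 \<in> sym_diff (walls m) (walls q)"
      and sep: "\<forall>x\<in>W. \<forall>y\<in>W. (r\<^sub>1 \<in> walls x \<longleftrightarrow> r\<^sub>1 \<in> walls m) \<longrightarrow> (r\<^sub>2 \<in> walls y \<longleftrightarrow> r\<^sub>2 \<in> walls q) \<longrightarrow>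
        wdist x v + wdist v y \<le> wdist x y + 2"
      by (rule ex_bottleneck[OF assms(1) U m(1) pq(2)]) (rule that)
    have "wdist p v + wdist v g \<le> wdist p g + 2"
      using sep[rule_format, OF pq(1) gW] r m pq by auto
    moreover have "wdist p g = card (walls g) - card (walls p)"
    proof -
      have "sym_diff (walls p) (walls g) = walls g - walls p" using pq by auto
      then show ?thesis using pq gW fin by (simp only: wdist_walls card_Diff_subset)
    qed
    moreover have vq: "walls v \<subseteq> walls q" using v m by auto
    moreover have "wdist v g = card (walls g) - card (walls v)"
    proof -
      have "sym_diff (walls v) (walls g) = walls g - walls v" using pq vq by auto
      moreover have "walls v \<subseteq> walls g" using vq pq by auto
      ultimately show ?thesis using v gW by (simp only: wdist_walls card_Diff_subset finite_walls)
    qed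
    moreover have "wdist p v = card (walls p - walls v) + card (walls v - walls p)"
      using pq v by (simp only: wdist_walls card_sym_diff finite_walls)
    moreover have "card (walls p) = card (walls p \<inter> walls v) + card (walls p - walls v)"
      using fin by (intro card_Int_Diff)
    moreover have "card (walls v) = card (walls p \<inter> walls v) + card (walls v - walls p)"
      using v(1) card_Int_Diff[of "walls v" "walls p"] by (simp add: Int_commute)
    moreover have "card (walls v) \<le> card (walls g)" "card (walls p) \<le> card (walls g)"
      using vq pq fin by (auto intro!: card_mono)
    moreover have "card (walls p - walls q) \<le> card (walls p - walls v)"
      using vq fin by (intro card_mono) auto
    ultimately show False using \<open>\<not> card (walls p - walls q) \<le> 2\<close> by linarith
  qed
  then show ?thesis using d pc qc le unfolding len_def by linarith
qed

lemma wdist_gate_height: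
  assumes "triangle_free \<Gamma>" "U \<subseteq> S" "thin_links U" "g \<in> special U" "x \<in> W" "y \<in> W"
  shows "real (wdist (gate g x) (gate g y)) \<le> \<bar>real (height g x) - real (height g y)\<bar> + 4"
proof -
  have gW: "g \<in> W" using special_closed assms by auto
  have len: "len (gate g z) = height g z" if "z \<in> W" for z
    unfolding len_def height_def using gate gW that by simp
  have *: "real (wdist (gate g x) (gate g y)) \<le> \<bar>real (height g x) - real (height g y)\<bar> + 4"
    if "x \<in> W" "y \<in> W" "height g x \<le> height g y" for x y
    using interval_thin[OF assms(1-4), of "gate g x" "gate g y"] that len gate[OF gW]
    by (simp flip: of_nat_diff)
  show ?thesis
    using *[of x y] *[of y x] assms(5,6) wdist_sym[of "gate g x" "gate g y"] gate[OF gW]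
    by (cases "height g x \<le> height g y") (auto simp: abs_minus_commute)
qed

lemma depth_lipschitz:
  assumes "g \<in> W" "x \<in> W" "y \<in> W"
  shows "\<bar>real (depth g x) - real (depth g y)\<bar> \<le> wdist x y"
proof -
  have *: "depth g x \<le> depth g y + wdist x y" if "x \<in> W" "y \<in> W" for x y
  proof -
    have "card (walls x - walls g) \<le> card ((walls y - walls g) \<union> sym_diff (walls x) (walls y))"
      using that by (intro card_mono) auto
    also have "\<dots> \<le> card (walls y - walls g) + card (sym_diff (walls x) (walls y))"
      by (rule card_Un_le)
    finally show ?thesis unfolding depth_def using that by (simp only: wdist_walls)
  qed
  show ?thesis using *[of x y] *[of y x] wdist_sym[of x y] assms by simp
qed

lemma height_lipschitz:
  assumes "g \<in> W" "x \<in> W" "y \<in> W"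
  shows "\<bar>real (height g x) - real (height g y)\<bar> \<le> wdist x y"
proof -
  have *: "height g x \<le> height g y + wdist x y" if "x \<in> W" "y \<in> W" for x y
  proof -
    have "card (walls x \<inter> walls g) \<le> card ((walls y \<inter> walls g) \<union> sym_diff (walls x) (walls y))"
      using that by (intro card_mono) auto
    also have "\<dots> \<le> card (walls y \<inter> walls g) + card (sym_diff (walls x) (walls y))"
      by (rule card_Un_le)
    finally show ?thesis unfolding height_def using that by (simp only: wdist_walls)
  qed
  show ?thesis using *[of x y] *[of y x] wdist_sym[of x y] assms by simp
qed


section \<open>Quasi-geodesics ending in a special subgroup\<close>

definition discrete_quasi_geodesic :: "real \<Rightarrow> real \<Rightarrow> nat \<Rightarrow> (nat \<Rightarrow> 'a word set) \<Rightarrow> bool" where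
  "discrete_quasi_geodesic \<kappa> \<beta> m X \<longleftrightarrow> (\<forall>i\<le>m. X i \<in> W) \<and>
     (\<forall>i j. i \<le> j \<longrightarrow> j \<le> m \<longrightarrow> real (j - i) / \<kappa> - \<beta> \<le> real (wdist (X i) (X j)) \<and>
       real (wdist (X i) (X j)) \<le> \<kappa> * real (j - i) + \<beta>)"

text \<open>The abstract excursion lemma, for the interval between \<open>1\<close> and \<open>g\<close>.\<close>

lemma depth_bound:
  assumes "triangle_free \<Gamma>" and U: "U \<subseteq> S" "thin_links U" and g: "g \<in> special U"
    and \<kappa>: "1 \<le> \<kappa>" "0 \<le> \<beta>" and X: "discrete_quasi_geodesic \<kappa> \<beta> m X" "X 0 = e" "X m = g" "i \<le> m"
  shows "depth g (X i) \<le> excursion_height \<kappa> \<beta>"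
proof (rule excursion_bound[OF \<kappa>, where m = m and \<delta> = "\<lambda>i j. real (wdist (X i) (X j))"
      and \<epsilon> = "\<lambda>i j. real (wdist (gate g (X i)) (gate g (X j)))" and D = "\<lambda>i. real (depth g (X i))"])
  have gW: "g \<in> W" using special_closed U g by auto
  have XW: "X i \<in> W" if "i \<le> m" for i using X that unfolding discrete_quasi_geodesic_def by auto
  note gates = gate[OF gW]
  fix i j assume ij: "i \<le> j" "j \<le> m"
  then have W: "X i \<in> W" "X j \<in> W" using XW by auto
  show "real (wdist (X i) (X j)) \<le> \<kappa> * real (j - i) + \<beta>"
    "real (j - i) / \<kappa> - \<beta> \<le> real (wdist (X i) (X j))"
    using X ij unfolding discrete_quasi_geodesic_def by auto
  show "\<bar>real (depth g (X i)) - real (depth g (X j))\<bar> \<le> real (wdist (X i) (X j))"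
    by (rule depth_lipschitz[OF gW W])
  have "wdist (X i) (X j) \<le> wdist (X i) (gate g (X i)) + wdist (gate g (X i)) (X j)"
    using W gates by (intro wdist_triangle) auto
  also have "wdist (gate g (X i)) (X j) \<le> wdist (gate g (X i)) (gate g (X j)) + wdist (gate g (X j)) (X j)"
    using W gates by (intro wdist_triangle) auto
  also have "wdist (gate g (X j)) (X j) = depth g (X j)"
    using wdist_gate[OF gW W(2)] wdist_sym[OF W(2) gates(1)[OF W(2)]] by simp
  finally show "real (wdist (X i) (X j)) \<le> real (depth g (X i)) +
      real (wdist (gate g (X i)) (gate g (X j))) + real (depth g (X j))"
    unfolding wdist_gate[OF gW W(1)] by simp
  show "real (depth g (X i)) + real (depth g (X j)) \<le> real (wdist (X i) (X j)) + 2"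
    if "2 < real (wdist (gate g (X i)) (gate g (X j)))"
    using contraction[OF assms(1) U g W] that by simp
next
  have gW: "g \<in> W" using special_closed U g by auto
  fix i j k assume "i \<le> j" "j \<le> k" "k \<le> m"
  then have "X i \<in> W" "X j \<in> W" "X k \<in> W" using X unfolding discrete_quasi_geodesic_def by auto
  then show "real (wdist (gate g (X i)) (gate g (X k))) \<le>
      real (wdist (gate g (X i)) (gate g (X j))) + real (wdist (gate g (X j)) (gate g (X k)))"
    using wdist_triangle[of "gate g (X i)" "gate g (X j)" "gate g (X k)"] gate[OF gW] by simp
qed (use X in \<open>auto simp: depth_def\<close>)

text \<open>Both sequences stay close to the interval, and their heights run through the same range.
  Hence \<open>Y\<close> has a point of nearly the same height as \<open>X i\<close>, and thinness applies to the gates.\<close>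

lemma fellow_travel_from_one:
  assumes "triangle_free \<Gamma>" and U: "U \<subseteq> S" "thin_links U" and g: "g \<in> special U"
    and \<kappa>: "1 \<le> \<kappa>" "0 \<le> \<beta>" and X: "discrete_quasi_geodesic \<kappa> \<beta> m X" "X 0 = e" "X m = g" "i \<le> m"
    and Y: "discrete_quasi_geodesic \<kappa> \<beta> n Y" "Y 0 = e" "Y n = g"
  shows "\<exists>j\<le>n. real (wdist (X i) (Y j)) \<le> 2 * excursion_height \<kappa> \<beta> + \<kappa> + \<beta> + 4"
proof -
  have gW: "g \<in> W" using special_closed U g by auto
  have Xi: "X i \<in> W" using X unfolding discrete_quasi_geodesic_def by auto
  have YW: "Y i \<in> W" if "i \<le> n" for i using Y that unfolding discrete_quasi_geodesic_def by auto
  note gates = gate[OF gW]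
  obtain j where j: "j \<le> n" "\<bar>real (height g (Y j)) - real (height g (X i))\<bar> \<le> \<kappa> + \<beta>"
  proof -
    have "\<exists>j\<le>n. \<bar>real (height g (Y j)) - real (height g (X i))\<bar> \<le> \<kappa> + \<beta>"
    proof (rule discrete_intermediate_value)
      show "real (height g (Y 0)) \<le> real (height g (X i))" using Y by (simp add: height_def)
      show "real (height g (X i)) \<le> real (height g (Y n))"
        using Y gW unfolding height_def by (auto intro: card_mono)
      show "\<bar>real (height g (Y (Suc i))) - real (height g (Y i))\<bar> \<le> \<kappa> + \<beta>" if "i < n" for i
      proof -
        have "real (wdist (Y i) (Y (Suc i))) \<le> \<kappa> * real (Suc i - i) + \<beta>"
          using Y(1) that unfolding discrete_quasi_geodesic_def by (metis Suc_leI le_SucI order_refl)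
        then show ?thesis
          using height_lipschitz[OF gW YW YW, of i "Suc i"] that by (simp add: abs_minus_commute)
      qed
    qed (use \<kappa> in simp)
    then show thesis using that by blast
  qed
  have Yj: "Y j \<in> W" using YW j by simp
  have "wdist (X i) (Y j) \<le> wdist (X i) (gate g (X i)) + wdist (gate g (X i)) (Y j)"
    using Xi gates by (intro wdist_triangle Yj) auto
  also have "wdist (gate g (X i)) (Y j) \<le> wdist (gate g (X i)) (gate g (Y j)) + wdist (gate g (Y j)) (Y j)"
    using Xi Yj gates by (intro wdist_triangle) auto
  also have "wdist (gate g (Y j)) (Y j) = depth g (Y j)"
    using wdist_gate[OF gW Yj] wdist_sym[OF Yj gates(1)[OF Yj]] by simp
  finally have "real (wdist (X i) (Y j)) \<le>
      real (depth g (X i)) + real (wdist (gate g (X i)) (gate g (Y j))) + real (depth g (Y j))"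
    unfolding wdist_gate[OF gW Xi] by simp
  moreover have "real (wdist (gate g (X i)) (gate g (Y j))) \<le> \<kappa> + \<beta> + 4"
    using wdist_gate_height[OF assms(1) U g Xi Yj] j(2) by (simp add: abs_minus_commute)
  moreover have "real (depth g (X i)) \<le> excursion_height \<kappa> \<beta>" "real (depth g (Y j)) \<le> excursion_height \<kappa> \<beta>"
    using depth_bound[OF assms(1) U g \<kappa>] X Y j by auto
  ultimately show ?thesis using j(1) by (intro exI[of _ j]) simp
qed

lemma fellow_travel:
  assumes "triangle_free \<Gamma>" and U: "U \<subseteq> S" "thin_links U" and h: "h \<in> special U" "h' \<in> special U"
    and \<kappa>: "1 \<le> \<kappa>" "0 \<le> \<beta>" and X: "discrete_quasi_geodesic \<kappa> \<beta> m X" "X 0 = h" "X m = h'" "i \<le> m"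
    and Y: "discrete_quasi_geodesic \<kappa> \<beta> n Y" "Y 0 = h" "Y n = h'"
  shows "\<exists>j\<le>n. real (wdist (X i) (Y j)) \<le> 2 * excursion_height \<kappa> \<beta> + \<kappa> + \<beta> + 4"
proof -
  interpret K: subgroup "special U" "racg \<Gamma>" by (rule special_subgroup[OF U(1)])
  have hW: "h \<in> W" using special_closed U h by auto
  have XW: "X i \<in> W" if "i \<le> m" for i using X that unfolding discrete_quasi_geodesic_def by auto
  have YW: "Y i \<in> W" if "i \<le> n" for i using Y that unfolding discrete_quasi_geodesic_def by auto
  have tr: "wdist (iv h \<cdot> x) (iv h \<cdot> y) = wdist x y" if "x \<in> W" "y \<in> W" for x y
    using wdist_translate hW that by simp
  have move: "discrete_quasi_geodesic \<kappa> \<beta> k (\<lambda>i. iv h \<cdot> Z i)"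
    if Z: "discrete_quasi_geodesic \<kappa> \<beta> k Z" for k Z
    unfolding discrete_quasi_geodesic_def
  proof (intro conjI allI impI)
    show "iv h \<cdot> Z i \<in> W" if "i \<le> k" for i
      using that Z hW unfolding discrete_quasi_geodesic_def by auto
    fix i j assume ij: "i \<le> j" "j \<le> k"
    then have "Z i \<in> W" "Z j \<in> W" using Z unfolding discrete_quasi_geodesic_def by auto
    from tr[OF this] show "real (j - i) / \<kappa> - \<beta> \<le> real (wdist (iv h \<cdot> Z i) (iv h \<cdot> Z j))"
      "real (wdist (iv h \<cdot> Z i) (iv h \<cdot> Z j)) \<le> \<kappa> * real (j - i) + \<beta>"
      using ij Z unfolding discrete_quasi_geodesic_def by simp_all
  qed
  have "\<exists>j\<le>n. real (wdist (iv h \<cdot> X i) (iv h \<cdot> Y j)) \<le> 2 * excursion_height \<kappa> \<beta> + \<kappa> + \<beta> + 4"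
    using fellow_travel_from_one[OF assms(1) U _ \<kappa> move[OF X(1)] _ _ X(4) move[OF Y(1)], of "iv h \<cdot> h'"]
      X Y hW h by auto
  then show ?thesis using tr XW YW X(4) by auto
qed

section \<open>The Cayley graph of a special subgroup\<close>

abbreviation special_group where "special_group U \<equiv> (racg \<Gamma>)\<lparr>carrier := special U\<rparr>"

lemma special_full: "special S = W"
  using generate_ev[of S] by (auto dest: ev_surj)

text \<open>The whole group is a special subgroup, and what is shown for the Cayley graphs of special
  subgroups applies to it.\<close>

lemma special_group_full: "special_group S = racg \<Gamma>"
  by (simp add: special_full)

text \<open>Reduced words for elements of a special subgroup use its own generators only, so word
  length in the subgroup is word length in the whole group.\<close>

lemma special_path:
  assumes "U \<subseteq> S" "u \<in> special U" "k \<in> special U"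
  shows "cayley_path (special_group U) (\<sigma> ` U) (cayley_vertex u) (len k) (cayley_vertex (u \<cdot> k))"
proof -
  interpret K: subgroup "special U" "racg \<Gamma>" by (rule special_subgroup[OF assms(1)])
  have "k \<in> W" using assms special_closed by auto
  then show ?thesis using assms(2,3)
  proof (induction arbitrary: u rule: descent_induct)
    case one
    then show ?case using cayley_path_vertex[of u "special_group U"] special_closed[OF assms(1)]
      by (simp add: len_def)
  next
    case (mult s h)
    have u: "u \<in> W" using special_closed[OF assms(1)] mult by auto
    have "\<sigma> s \<in> walls (\<sigma> s \<cdot> h)" using mult gen_in_walls_gen_mult by auto
    then have s: "s \<in> U" "\<sigma> s \<in> special U"
      using special_descent[OF assms(1), of "\<sigma> s \<cdot> h" s] mult generate.incl[of "\<sigma> s" "\<sigma> ` U"] by auto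
    have h: "h \<in> special U"
      using K.m_closed[OF s(2) \<open>\<sigma> s \<cdot> h \<in> special U\<close>] mult by simp
    have "\<sigma> s \<noteq> e" using walls_gen[OF \<open>s \<in> S\<close>] by (metis walls_one insert_not_empty)
    then have "cayley_adj (special_group U) (\<sigma> ` U) u (u \<cdot> \<sigma> s)"
      unfolding cayley_adj_def using mult u s by auto
    from cayley_path_trans[OF mult.IH[of "u \<cdot> \<sigma> s"] cayley_path_edge[OF this]]
    have "cayley_path (special_group U) (\<sigma> ` U) (cayley_vertex u) (1 + real (len h)) (cayley_vertex (u \<cdot> (\<sigma> s \<cdot> h)))"
      using mult u s h by (simp add: grp)
    then show ?case using mult len_gen_mult(2)[of s h] by simp
  qed
qed

lemma special_dist_le:
  assumes "U \<subseteq> S" "u \<in> special U" "v \<in> special U"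
  shows "cayley_dist (special_group U) (\<sigma> ` U) (cayley_vertex u) (cayley_vertex v) \<le> wdist u v"
proof -
  interpret K: subgroup "special U" "racg \<Gamma>" by (rule special_subgroup[OF assms(1)])
  have "cayley_path (special_group U) (\<sigma> ` U) (cayley_vertex u) (len (iv u \<cdot> v)) (cayley_vertex (u \<cdot> (iv u \<cdot> v)))"
    using assms by (intro special_path) auto
  then show ?thesis
    using assms special_closed by (auto simp: wdist_def intro: cayley_dist_le)
qed

lemma finite_generating_special:
  assumes "U \<subseteq> S"
  shows "finite_generating_set (special_group U) (\<sigma> ` U)"
proof -
  have "generate (special_group U) (\<sigma> ` U) = special U"
    using G.generate_consistent[OF _ special_subgroup[OF assms]] by (auto intro: generate.incl)
  then show ?thesis
    using finite_subset[OF assms finite_S] unfolding finite_generating_set_def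
    by (auto intro: generate.incl)
qed

lemma special_group_group: "U \<subseteq> S \<Longrightarrow> group (special_group U)"
  using special_subgroup G.subgroup_imp_group by blast

lemma special_connected:
  assumes "U \<subseteq> S" "x \<in> cayley_points (special_group U) (\<sigma> ` U)" "y \<in> cayley_points (special_group U) (\<sigma> ` U)"
  shows "\<exists>l. cayley_path (special_group U) (\<sigma> ` U) x l y"
proof -
  interpret H: group "special_group U" by (rule special_group_group[OF assms(1)])
  show ?thesis
    using H.cayley_connected[of "\<sigma> ` U" x y] finite_generating_special[OF assms(1)] assms(2,3)
    unfolding finite_generating_set_def by metis
qed

abbreviation cpoints where "cpoints \<equiv> cayley_points (racg \<Gamma>) (\<sigma> ` S)"
abbreviation cdist where "cdist \<equiv> cayley_dist (racg \<Gamma>) (\<sigma> ` S)"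

lemma connected: "x \<in> cpoints \<Longrightarrow> y \<in> cpoints \<Longrightarrow> \<exists>l. cayley_path (racg \<Gamma>) (\<sigma> ` S) x l y"
  using special_connected[of S] by (simp only: special_group_full order_refl)

lemma d_triangle: "x \<in> cpoints \<Longrightarrow> y \<in> cpoints \<Longrightarrow> z \<in> cpoints \<Longrightarrow> cdist x z \<le> cdist x y + cdist y z"
  using connected cayley_dist_triangle by metis

lemma vertex_P: "g \<in> W \<Longrightarrow> cayley_vertex g \<in> cpoints"
  by (simp add: cayley_points_def)

lemma d_vertex:
  assumes "u \<in> W" "v \<in> W"
  shows "cdist (cayley_vertex u) (cayley_vertex v) = wdist u v"
proof (rule antisym)
  show "cdist (cayley_vertex u) (cayley_vertex v) \<le> wdist u v"
    by (rule special_dist_le[OF order_refl, of u v, unfolded special_group_full, unfolded special_full, OF assms])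
  have step: "\<bar>real (wdist u g) - real (wdist u h)\<bar> \<le> 1" if "cayley_adj (racg \<Gamma>) (\<sigma> ` S) g h" for g h
  proof -
    have "wdist g (g \<cdot> \<sigma> s) = 1" if "g \<in> W" "s \<in> S" for g s
      using that by (simp add: wdist_def len_def)
    then have "wdist g h = 1" "g \<in> W" "h \<in> W"
      using that wdist_sym[of g h] unfolding cayley_adj_def by auto
    then show ?thesis
      using wdist_triangle[of u g h] wdist_triangle[of u h g] wdist_sym[of g h] assms by simp
  qed
  obtain l where "cayley_path (racg \<Gamma>) (\<sigma> ` S) (cayley_vertex u) l (cayley_vertex v)"
    using connected vertex_P assms by metis
  from cayley_dist_lipschitz[where F = "\<lambda>g. real (wdist u g)", OF this zero_less_one step]
  show "wdist u v \<le> cdist (cayley_vertex u) (cayley_vertex v)"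
    using assms by (simp add: wdist_def len_def)
qed

text \<open>The last condition makes sure that vertices are not moved, so that the ends of quasi-geodesics
  stay in the subgroup.\<close>

definition nearest :: "('a word set \<Rightarrow> real) \<Rightarrow> 'a word set" where
  "nearest x = (SOME g. g \<in> W \<and> cdist x (cayley_vertex g) \<le> 1 \<and> (\<forall>h\<in>W. x = cayley_vertex h \<longrightarrow> g = h))"

lemma nearest:
  assumes "x \<in> cpoints"
  shows "nearest x \<in> W \<and> cdist x (cayley_vertex (nearest x)) \<le> 1 \<and> (\<forall>h\<in>W. x = cayley_vertex h \<longrightarrow> nearest x = h)"
proof -
  have "\<exists>g. g \<in> W \<and> cdist x (cayley_vertex g) \<le> 1 \<and> (\<forall>h\<in>W. x = cayley_vertex h \<longrightarrow> g = h)"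
  proof (cases "x \<in> cayley_vertex ` W")
    case True
    then obtain g where g: "g \<in> W" "x = cayley_vertex g" by auto
    have "cdist x (cayley_vertex g) \<le> 0"
      using g cayley_path_vertex by (intro cayley_dist_le) auto
    then show ?thesis using g by (intro exI[of _ g]) auto
  next
    case False
    obtain g l where "g \<in> W" "l \<le> 1" "cayley_path (racg \<Gamma>) (\<sigma> ` S) x l (cayley_vertex g)"
      by (rule near_vertex[OF assms])
    moreover from this have "cdist x (cayley_vertex g) \<le> 1"
      by (auto intro: order_trans[OF cayley_dist_le])
    ultimately show ?thesis using False by (intro exI[of _ g]) auto
  qed
  from someI_ex[OF this] show ?thesis unfolding nearest_def .
qed

lemma nearest_vertex [simp]: "g \<in> W \<Longrightarrow> nearest (cayley_vertex g) = g"
  using nearest[OF vertex_P, of g] by blast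

lemma nearest_dist:
  assumes "x \<in> cpoints" "y \<in> cpoints"
  shows "\<bar>cdist x y - wdist (nearest x) (nearest y)\<bar> \<le> 2"
proof -
  let ?x = "cayley_vertex (nearest x)" and ?y = "cayley_vertex (nearest y)"
  have W: "nearest x \<in> W" "nearest y \<in> W" and le: "cdist x ?x \<le> 1" "cdist y ?y \<le> 1" using nearest assms by auto
  have pts: "?x \<in> cpoints" "?y \<in> cpoints" using W vertex_P by auto
  have "cdist x y \<le> cdist x ?x + (cdist ?x ?y + cdist ?y y)" "cdist ?x ?y \<le> cdist ?x x + (cdist x y + cdist y ?y)"
    using assms pts d_triangle[of x ?x y] d_triangle[of ?x ?y y] d_triangle[of ?x x ?y] d_triangle[of x y ?y]
    by linarith+
  then show ?thesis
    using le d_vertex[OF W] cayley_dist_sym[of "racg \<Gamma>" "\<sigma> ` S" x ?x]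
      cayley_dist_sym[of "racg \<Gamma>" "\<sigma> ` S" y ?y] by linarith
qed

text \<open>The Cayley graph of a special subgroup is a subgraph, and points of the metric graphs are given
  by the same barycentric coordinates, so the extension of the inclusion is the identity.\<close>

lemma undistorted_special:
  assumes U: "U \<subseteq> S"
  shows "undistorted (racg \<Gamma>) (\<sigma> ` S) (special U) (\<sigma> ` U)"
proof -
  let ?H = "special_group U"
  let ?PH = "cayley_points ?H (\<sigma> ` U)" and ?dH = "cayley_dist ?H (\<sigma> ` U)"
  have adj: "cayley_adj (racg \<Gamma>) (\<sigma> ` S) g h" if "cayley_adj ?H (\<sigma> ` U) g h" for g h
    using that U special_closed[OF U] unfolding cayley_adj_def by auto
  have pts: "x \<in> cpoints" if "x \<in> ?PH" for x
    using that adj special_closed[OF U] unfolding cayley_points_def by fastforce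
  have path: "cayley_path (racg \<Gamma>) (\<sigma> ` S) x l y" if "cayley_path ?H (\<sigma> ` U) x l y" for x l y
    using that
  proof (induction rule: cayley_path.induct)
    case path_start
    then show ?case by (intro cayley_path.path_start pts)
  next
    case (path_segment l g h s t)
    then show ?case using adj by (intro cayley_path.path_segment)
  qed
  have le: "cdist x y \<le> ?dH x y" if xy: "x \<in> ?PH" "y \<in> ?PH" for x y
  proof -
    obtain l where l: "cayley_path ?H (\<sigma> ` U) x l y" using special_connected[OF U xy] by blast
    show ?thesis by (rule cayley_dist_ge[OF l]) (rule cayley_dist_le[OF path])
  qed
  have ge: "?dH x y \<le> cdist x y + 4" if xy: "x \<in> ?PH" "y \<in> ?PH" for x y
  proof -
    obtain g l where "g \<in> carrier ?H" "l \<le> 1" "cayley_path ?H (\<sigma> ` U) x l (cayley_vertex g)"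
      by (rule near_vertex[OF xy(1)])
    then have g: "g \<in> special U" "?dH x (cayley_vertex g) \<le> 1"
      by (auto intro: order_trans[OF cayley_dist_le])
    obtain h k where "h \<in> carrier ?H" "k \<le> 1" "cayley_path ?H (\<sigma> ` U) y k (cayley_vertex h)"
      by (rule near_vertex[OF xy(2)])
    then have h: "h \<in> special U" "?dH y (cayley_vertex h) \<le> 1"
      by (auto intro: order_trans[OF cayley_dist_le])
    have gh: "cayley_vertex g \<in> ?PH" "cayley_vertex h \<in> ?PH" using g h by (auto simp: cayley_points_def)
    have tri: "?dH a c \<le> ?dH a b + ?dH b c" if "a \<in> ?PH" "b \<in> ?PH" "c \<in> ?PH" for a b c
      using special_connected[OF U] cayley_dist_triangle that by metis
    have W: "g \<in> W" "h \<in> W" using special_closed[OF U] g h by auto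
    have "?dH x y \<le> 1 + ?dH (cayley_vertex g) (cayley_vertex h) + 1"
      using tri[OF xy(1) gh(1) xy(2)] tri[OF gh(1) gh(2) xy(2)] g h
        cayley_dist_sym[of ?H "\<sigma> ` U" y "cayley_vertex h"] by simp
    also have "\<dots> \<le> 1 + cdist (cayley_vertex g) (cayley_vertex h) + 1"
      using special_dist_le[OF U g(1) h(1)] d_vertex[OF W] by simp
    also have "cdist (cayley_vertex g) (cayley_vertex h) \<le> 1 + (cdist x y + 1)"
    proof -
      have "cdist (cayley_vertex g) x \<le> 1" "cdist y (cayley_vertex h) \<le> 1"
        using le[OF xy(1) gh(1)] le[OF xy(2) gh(2)] g h cayley_dist_sym[of "racg \<Gamma>" "\<sigma> ` S" x] by auto
      then show ?thesis
        using d_triangle[of "cayley_vertex g" x "cayley_vertex h"] d_triangle[of x y "cayley_vertex h"]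
          pts[OF xy(1)] pts[OF xy(2)] vertex_P W by force
    qed
    finally show ?thesis by simp
  qed
  have "qi_embedding 1 4 ?PH ?dH cpoints cdist id"
    unfolding qi_embedding_def
  proof (intro conjI ballI)
    fix x y assume xy: "x \<in> ?PH" "y \<in> ?PH"
    show "1 / 1 * ?dH x y - 4 \<le> cdist (id x) (id y)" "cdist (id x) (id y) \<le> 1 * ?dH x y + 4"
      using le[OF xy] ge[OF xy] by simp_all
  qed (use pts in auto)
  then show ?thesis unfolding undistorted_def
    by (intro exI[of _ 1] exI[of _ 4] exI[of _ id] conjI) auto
qed

section \<open>Stability from thin links\<close>

text \<open>Sampling at unit steps, and once more at the end \<open>b\<close>, the quasi-geodesic is replaced by a sequence of
  vertices. The last step may be shorter than \<open>1\<close>, which together with the rounding to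
  vertices accounts for the increment \<open>3\<close> of the additive constant.\<close>

lemma discretise:
  assumes "1 \<le> \<kappa>" "0 \<le> L" and f: "quasi_geodesic \<kappa> L cpoints cdist a b f"
  defines "m \<equiv> nat \<lceil>b - a\<rceil>"
  defines "\<theta> \<equiv> \<lambda>i. min (a + real i) b"
  shows "discrete_quasi_geodesic \<kappa> (L + 3) m (\<lambda>i. nearest (f (\<theta> i)))"
    and "\<theta> 0 = a" "\<theta> m = b"
    and "\<And>i. \<theta> i \<in> {a..b}"
    and "\<And>t. t \<in> {a..b} \<Longrightarrow> \<exists>i\<le>m. cdist (f t) (f (\<theta> i)) \<le> \<kappa> + L"
proof -
  have ab: "a \<le> b" using f unfolding quasi_geodesic_def by auto
  have fP: "f t \<in> cpoints" if "t \<in> {a..b}" for t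
    using f that unfolding quasi_geodesic_def qi_embedding_def by auto
  have qi: "1 / \<kappa> * \<bar>s - t\<bar> - L \<le> cdist (f s) (f t)" "cdist (f s) (f t) \<le> \<kappa> * \<bar>s - t\<bar> + L"
    if "s \<in> {a..b}" "t \<in> {a..b}" for s t
    using f that unfolding quasi_geodesic_def qi_embedding_def dist_real_def by auto
  show \<theta>: "\<theta> i \<in> {a..b}" for i unfolding \<theta>_def using ab by auto
  show "\<theta> 0 = a" unfolding \<theta>_def using ab by simp
  have m: "b - a \<le> real m" "real m < b - a + 1" unfolding m_def using ab by linarith+
  show "\<theta> m = b" unfolding \<theta>_def using m by simp
  show "discrete_quasi_geodesic \<kappa> (L + 3) m (\<lambda>i. nearest (f (\<theta> i)))"
    unfolding discrete_quasi_geodesic_def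
  proof (intro conjI allI impI)
    show "nearest (f (\<theta> i)) \<in> W" for i using nearest fP \<theta> by blast
    fix i j assume ij: "i \<le> j" "j \<le> m"
    have near: "\<bar>cdist (f (\<theta> i)) (f (\<theta> j)) - real (wdist (nearest (f (\<theta> i))) (nearest (f (\<theta> j))))\<bar> \<le> 2"
      by (intro nearest_dist fP \<theta>)
    have upper: "\<bar>\<theta> i - \<theta> j\<bar> \<le> real (j - i)" unfolding \<theta>_def using ij by (auto simp: min_def)
    have lower: "real (j - i) - 1 \<le> \<bar>\<theta> i - \<theta> j\<bar>"
    proof (cases "i = m")
      case False
      then have "real i + 1 \<le> real m" using ij by linarith
      then have "\<theta> i = a + real i" unfolding \<theta>_def using m by simp
      moreover have "real j \<le> real m" using ij by simp
      then have "a + real j - 1 \<le> \<theta> j" unfolding \<theta>_def using m by simp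
      ultimately show ?thesis using ij by (simp add: of_nat_diff)
    qed (use ij in simp)
    have "\<kappa> * \<bar>\<theta> i - \<theta> j\<bar> \<le> \<kappa> * real (j - i)" using upper assms(1) by (intro mult_left_mono) auto
    then show "real (wdist (nearest (f (\<theta> i))) (nearest (f (\<theta> j)))) \<le> \<kappa> * real (j - i) + (L + 3)"
      using near qi(2)[OF \<theta> \<theta>, of i j] by linarith
    have "1 / \<kappa> * (real (j - i) - 1) \<le> 1 / \<kappa> * \<bar>\<theta> i - \<theta> j\<bar>" using lower assms(1) by (intro mult_left_mono) auto
    moreover have "1 / \<kappa> * (real (j - i) - 1) = real (j - i) / \<kappa> - 1 / \<kappa>" by (simp add: diff_divide_distrib)
    moreover have "1 / \<kappa> \<le> 1" using assms(1) by simp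
    ultimately show "real (j - i) / \<kappa> - (L + 3) \<le> real (wdist (nearest (f (\<theta> i))) (nearest (f (\<theta> j))))"
      using near qi(1)[OF \<theta> \<theta>, of i j] by linarith
  qed
  fix t assume t: "t \<in> {a..b}"
  define i where "i = nat \<lfloor>t - a\<rfloor>"
  have i: "real i \<le> t - a" "t - a < real i + 1" unfolding i_def using t by simp_all
  have "\<theta> i = a + real i" unfolding \<theta>_def using i t by simp
  then have "\<bar>t - \<theta> i\<bar> \<le> 1" using i by simp
  then have "\<kappa> * \<bar>t - \<theta> i\<bar> \<le> \<kappa> * 1" using assms(1) by (intro mult_left_mono) auto
  then have "cdist (f t) (f (\<theta> i)) \<le> \<kappa> + L" using qi(2)[OF t \<theta>, of i] by linarith
  moreover have "real i \<le> real m" using i t m by simp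
  ultimately show "\<exists>i\<le>m. cdist (f t) (f (\<theta> i)) \<le> \<kappa> + L" by (intro exI[of _ i]) simp
qed

lemma quasi_geodesics_close:
  assumes "triangle_free \<Gamma>" and U: "U \<subseteq> S" "thin_links U" and \<kappa>: "1 \<le> \<kappa>" "0 \<le> L"
    and f: "quasi_geodesic \<kappa> L cpoints cdist a b f" and f': "quasi_geodesic \<kappa> L cpoints cdist a' b' f'"
    and ends: "f a = f' a'" "f b = f' b'" "f a = cayley_vertex h" "f b = cayley_vertex h'"
      "h \<in> special U" "h' \<in> special U"
    and t: "t \<in> {a..b}"
  shows "\<exists>t'\<in>{a'..b'}. cdist (f t) (f' t') \<le>
    (\<kappa> + L) + (2 * excursion_height \<kappa> (L + 3) + \<kappa> + (L + 3) + 4 + 2)"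
proof -
  define m where "m = nat \<lceil>b - a\<rceil>"
  define \<theta> where "\<theta> i = min (a + real i) b" for i
  define n where "n = nat \<lceil>b' - a'\<rceil>"
  define \<eta> where "\<eta> i = min (a' + real i) b'" for i
  note D = discretise[OF \<kappa> f, folded m_def \<theta>_def] and D' = discretise[OF \<kappa> f', folded n_def \<eta>_def]
  have fP: "f t \<in> cpoints" if "t \<in> {a..b}" for t
    using f that unfolding quasi_geodesic_def qi_embedding_def by auto
  have fP': "f' t \<in> cpoints" if "t \<in> {a'..b'}" for t
    using f' that unfolding quasi_geodesic_def qi_embedding_def by auto
  obtain i where i: "i \<le> m" "cdist (f t) (f (\<theta> i)) \<le> \<kappa> + L" using D(5)[OF t] by (elim exE conjE) (rule that)
  have W: "h \<in> W" "h' \<in> W"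
    by (rule special_closed[OF U(1) ends(5)], rule special_closed[OF U(1) ends(6)])
  have "0 \<le> L + 3" using \<kappa> by simp
  have start: "nearest (f (\<theta> 0)) = h" "nearest (f' (\<eta> 0)) = h"
    and finish: "nearest (f (\<theta> m)) = h'" "nearest (f' (\<eta> n)) = h'"
    unfolding D(2,3) D'(2,3) ends(1,2)[symmetric] ends(3,4) using W by simp_all
  obtain j where j: "j \<le> n" "real (wdist (nearest (f (\<theta> i))) (nearest (f' (\<eta> j)))) \<le>
      2 * excursion_height \<kappa> (L + 3) + \<kappa> + (L + 3) + 4"
    using fellow_travel[OF assms(1) U ends(5,6) \<kappa>(1) \<open>0 \<le> L + 3\<close> D(1) start(1) finish(1) i(1) D'(1)
      start(2) finish(2)] by (elim exE conjE) (rule that)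
  have close: "cdist (f (\<theta> i)) (f' (\<eta> j)) \<le> 2 * excursion_height \<kappa> (L + 3) + \<kappa> + (L + 3) + 4 + 2"
    using nearest_dist[OF fP[OF D(4)] fP'[OF D'(4)], of i j] j(2) by linarith
  have "cdist (f t) (f' (\<eta> j)) \<le> cdist (f t) (f (\<theta> i)) + cdist (f (\<theta> i)) (f' (\<eta> j))"
    by (intro d_triangle fP fP' t D(4) D'(4))
  also note add_mono[OF i(2) close]
  finally show ?thesis using D'(4)[of j] by blast
qed

lemma stable_special:
  assumes "triangle_free \<Gamma>" and U: "U \<subseteq> S" "thin_links U"
  shows "stable_subgroup (racg \<Gamma>) (special U)"
  unfolding stable_subgroup_def
proof (intro conjI, goal_cases sub ex)
  case sub
  show ?case by (rule special_subgroup[OF U(1)])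
next
  case ex
  show ?case
  proof (rule exI[of _ "\<sigma> ` S"], rule exI[of _ "\<sigma> ` U"], intro conjI allI impI)
    show "finite_generating_set (racg \<Gamma>) (\<sigma> ` S)"
      using finite_generating_special[of S] by (simp only: special_group_full order_refl)
    show "finite_generating_set (special_group U) (\<sigma> ` U)" by (rule finite_generating_special[OF U(1)])
    show "undistorted (racg \<Gamma>) (\<sigma> ` S) (special U) (\<sigma> ` U)" by (rule undistorted_special[OF U(1)])
    fix \<kappa> L :: real assume \<kappa>: "1 \<le> \<kappa>" "0 \<le> L"
    define C where "C = max 0 ((\<kappa> + L) + (2 * excursion_height \<kappa> (L + 3) + \<kappa> + (L + 3) + 4 + 2))"
    have C: "(\<kappa> + L) + (2 * excursion_height \<kappa> (L + 3) + \<kappa> + (L + 3) + 4 + 2) \<le> C" "0 \<le> C"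
      unfolding C_def by simp_all
    have close: "hausdorff_dist cdist (f ` {a..b}) (f' ` {a'..b'}) < ereal (C + 1)"
      if f: "quasi_geodesic \<kappa> L cpoints cdist a b f" and f': "quasi_geodesic \<kappa> L cpoints cdist a' b' f'"
        and ends: "f a = f' a'" "f b = f' b'" "{f a, f b} \<subseteq> cayley_vertex ` special U" for a b f a' b' f'
    proof -
      obtain h h' where h: "f a = cayley_vertex h" "f b = cayley_vertex h'" "h \<in> special U" "h' \<in> special U"
        using ends by auto
      have near: "\<exists>t'\<in>{a'..b'}. cdist (f t) (f' t') \<le> C" if "t \<in> {a..b}" for t
        using quasi_geodesics_close[OF assms \<kappa> f f' ends(1,2) h that] C(1) by (meson order_trans)
      have near': "\<exists>t\<in>{a..b}. cdist (f' t') (f t) \<le> C" if "t' \<in> {a'..b'}" for t'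
        using quasi_geodesics_close[OF assms \<kappa> f' f ends(1,2)[symmetric] _ _ h(3,4) that] C(1) ends(1,2) h(1,2)
        by (metis (no_types, lifting) order_trans)
      have "\<forall>p\<in>f ` {a..b}. \<exists>q\<in>f' ` {a'..b'}. cdist p q \<le> C" using near by auto
      moreover have "\<forall>q\<in>f' ` {a'..b'}. \<exists>p\<in>f ` {a..b}. cdist p q \<le> C"
        using near' cayley_dist_sym[of "racg \<Gamma>" "\<sigma> ` S"] by auto
      ultimately have "hausdorff_dist cdist (f ` {a..b}) (f' ` {a'..b'}) \<le> ereal C"
        unfolding hausdorff_dist_def using C(2) by (intro Inf_lower CollectI exI[of _ C] conjI refl)
      then show ?thesis by (rule le_less_trans) simp
    qed
    show "\<exists>R\<ge>0. \<forall>a b f a' b' f'.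
        quasi_geodesic \<kappa> L cpoints cdist a b f \<and> quasi_geodesic \<kappa> L cpoints cdist a' b' f' \<and>
        f a = f' a' \<and> f b = f' b' \<and> {f a, f b} \<subseteq> cayley_vertex ` special U \<longrightarrow>
        hausdorff_dist cdist (f ` {a..b}) (f' ` {a'..b'}) < ereal R"
    proof (intro exI[of _ "C + 1"] conjI allI impI)
      show "0 \<le> C + 1" using C(2) by simp
    qed (elim conjE, rule close)
  qed
qed


section \<open>Flats spanned by four-cycles\<close>

text \<open>The products of alternating letters \<open>s, t, s, \<dots>\<close>, built from the right such that consecutive
  ones are joined by an edge of the Cayley graph.\<close>

primrec zigzag :: "'a \<Rightarrow> 'a \<Rightarrow> nat \<Rightarrow> 'a word set" where
  "zigzag s t 0 = e"
| "zigzag s t (Suc n) = zigzag s t n \<cdot> \<sigma> (if even n then s else t)"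

lemma zigzag_special: "U \<subseteq> S \<Longrightarrow> s \<in> U \<Longrightarrow> t \<in> U \<Longrightarrow> zigzag s t n \<in> special U"
  by (induction n) (auto intro: generate.intros)

lemma zigzag_closed [simp]: "s \<in> S \<Longrightarrow> t \<in> S \<Longrightarrow> zigzag s t n \<in> W"
  by (induction n) auto

lemma zigzag_commute:
  assumes "adj u s" "adj u t"
  shows "\<sigma> u \<cdot> zigzag s t n = zigzag s t n \<cdot> \<sigma> u"
proof (induction n)
  case 0
  then show ?case using adj_verts[OF assms(1)] by simp
next
  case (Suc n)
  let ?c = "if even n then s else t"
  have c: "adj u ?c" using assms by simp
  have S: "u \<in> S" "s \<in> S" "t \<in> S" "?c \<in> S" using adj_verts assms by (auto split: if_splits)
  have "\<sigma> u \<cdot> zigzag s t (Suc n) = \<sigma> u \<cdot> zigzag s t n \<cdot> \<sigma> ?c" using S by (simp add: G.m_assoc)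
  also have "\<dots> = zigzag s t n \<cdot> (\<sigma> u \<cdot> \<sigma> ?c)" unfolding Suc.IH using S by (simp add: G.m_assoc)
  also have "\<sigma> u \<cdot> \<sigma> ?c = \<sigma> ?c \<cdot> \<sigma> u" by (rule gen_commute[OF c])
  finally show ?case using S by (simp add: G.m_assoc)
qed

definition line_position :: "'a \<Rightarrow> 'a \<Rightarrow> 'a word set \<Rightarrow> int" where
  "line_position s t g = racg_action (line_reflection s t) g 0"

lemma line_action_isometry:
  assumes "s \<noteq> t" "\<not> adj s t" "g \<in> W"
  shows "\<bar>racg_action (line_reflection s t) g z - racg_action (line_reflection s t) g z'\<bar> = \<bar>z - z'\<bar>"
proof -
  note inv = line_reflections[OF assms(1,2)]
  show ?thesis using assms(3)
  proof (induction rule: racg_induct)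
    case (mult u h)
    have "\<bar>line_reflection s t u x - line_reflection s t u y\<bar> = \<bar>x - y\<bar>" for x y
      by (auto simp: line_reflection_def abs_if)
    then show ?case using mult by (simp add: racg_action_mult[OF inv] racg_action_gen[OF inv])
  qed (simp add: racg_action_one[OF inv])
qed

text \<open>As the group acts by isometries, right multiplication by an element of any finite generating set
  changes the position by a bounded amount. Hence distances in any Cayley graph are bounded from below by
  multiples of differences of positions.\<close>

lemma line_position_step:
  assumes "s \<noteq> t" "\<not> adj s t" "g \<in> W" "a \<in> W"
  shows "\<bar>line_position s t (g \<cdot> a) - line_position s t g\<bar> = \<bar>line_position s t a\<bar>"
  using line_action_isometry[OF assms(1-3), of "line_position s t a" 0] assms
    racg_action_mult[OF line_reflections[OF assms(1,2)] assms(3,4)]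
  by (simp add: line_position_def)

lemma line_action_zigzag:
  assumes "s \<noteq> t" "\<not> adj s t" "s \<in> S" "t \<in> S"
  shows "racg_action (line_reflection s t) (zigzag s t n) z = (if even n then z - int n else - z - int n)"
proof (induction n arbitrary: z)
  case (Suc n)
  note inv = line_reflections[OF assms(1,2)]
  show ?case using Suc assms
    by (simp add: racg_action_mult[OF inv] racg_action_gen[OF inv])
qed (simp add: racg_action_one[OF line_reflections[OF assms(1,2)]])

lemma line_action_other_zigzag:
  assumes "s \<noteq> t" "\<not> adj s t" "u \<in> S" "w \<in> S" "{u, w} \<inter> {s, t} = {}"
  shows "racg_action (line_reflection s t) (zigzag u w n) z = z"
proof (induction n arbitrary: z)
  case (Suc n)
  note inv = line_reflections[OF assms(1,2)]
  have "u \<noteq> s" "u \<noteq> t" "w \<noteq> s" "w \<noteq> t" using assms(5) by auto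
  then show ?case using Suc assms(1-4)
    by (simp add: racg_action_mult[OF inv] racg_action_gen[OF inv])
qed (simp add: racg_action_one[OF line_reflections[OF assms(1,2)]])

text \<open>The coordinates at time \<open>i \<le> 3 * n\<close> of the path in the square grid that goes up \<open>n\<close> steps, along
  \<open>n\<close> steps, and down again.\<close>

definition detour_up :: "nat \<Rightarrow> nat \<Rightarrow> nat" where
  "detour_up n i = (if i \<le> 2 * n then min i n else 3 * n - i)"

definition detour_along :: "nat \<Rightarrow> nat \<Rightarrow> nat" where
  "detour_along n i = min (i - n) n"

text \<open>The worst case is a point on the way up and one on the way down: at most \<open>3 * n\<close> steps lie
  between them, and they are \<open>n\<close> apart in the other direction.\<close>

lemma detour_spread:
  assumes "i \<le> j" "j \<le> 3 * n"
  shows "real (j - i) \<le> 3 * \<bar>real (detour_up n j) - real (detour_up n i)\<bar> \<or>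
    real (j - i) \<le> 3 * \<bar>real (detour_along n j) - real (detour_along n i)\<bar>"
proof -
  have "int (j - i) \<le> 3 * \<bar>int (detour_up n j) - int (detour_up n i)\<bar> \<or>
      int (j - i) \<le> 3 * \<bar>int (detour_along n j) - int (detour_along n i)\<bar>"
    using assms unfolding detour_up_def detour_along_def by (auto simp: min_def split: if_splits)
  then have "real_of_int (int (j - i)) \<le> real_of_int (3 * \<bar>int (detour_up n j) - int (detour_up n i)\<bar>) \<or>
      real_of_int (int (j - i)) \<le> real_of_int (3 * \<bar>int (detour_along n j) - int (detour_along n i)\<bar>)"
    by (simp only: of_int_le_iff)
  then show ?thesis by simp
qed

lemma detour_step:
  assumes "i < 3 * n"
  shows "detour_up n (Suc i) = Suc (detour_up n i) \<and> detour_along n (Suc i) = 0 \<and> detour_along n i = 0 \<or>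
    detour_up n (Suc i) = detour_up n i \<and> detour_along n (Suc i) = Suc (detour_along n i) \<or>
    Suc (detour_up n (Suc i)) = detour_up n i \<and> detour_along n (Suc i) = detour_along n i"
  using assms unfolding detour_up_def detour_along_def by (auto simp: min_def)

text \<open>The path rests at \<open>P i\<close> for one unit of time and then jumps to the next point; the additive
  constant of a quasi-geodesic allows for that.\<close>

lemma quasi_geodesic_of_sequence:
  fixes P :: "nat \<Rightarrow> 'a word set" and m :: nat
  assumes "0 \<le> C" "1 \<le> M"
    and P: "\<And>i. i \<le> m \<Longrightarrow> P i \<in> W"
    and upper: "\<And>i j. i \<le> j \<Longrightarrow> j \<le> m \<Longrightarrow>
      cayley_dist (racg \<Gamma>) A (cayley_vertex (P i)) (cayley_vertex (P j)) \<le> C * real (j - i)"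
    and lower: "\<And>i j. i \<le> j \<Longrightarrow> j \<le> m \<Longrightarrow>
      real (j - i) / M \<le> cayley_dist (racg \<Gamma>) A (cayley_vertex (P i)) (cayley_vertex (P j))"
  shows "quasi_geodesic (M + C) (C + 1) (cayley_points (racg \<Gamma>) A) (cayley_dist (racg \<Gamma>) A)
    0 (real m) (\<lambda>t. cayley_vertex (P (nat \<lfloor>t\<rfloor>)))"
  unfolding quasi_geodesic_def qi_embedding_def
proof (intro conjI ballI)
  have m: "nat \<lfloor>t\<rfloor> \<le> m" if "t \<in> {0..real m}" for t using that by (auto simp: nat_le_iff floor_le_iff)
  show "(\<lambda>t. cayley_vertex (P (nat \<lfloor>t\<rfloor>))) \<in> {0..real m} \<rightarrow> cayley_points (racg \<Gamma>) A"
    using P m by (auto simp: cayley_points_def)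
  let ?d = "\<lambda>s t. cayley_dist (racg \<Gamma>) A (cayley_vertex (P (nat \<lfloor>s\<rfloor>))) (cayley_vertex (P (nat \<lfloor>t\<rfloor>)))"
  have *: "1 / (M + C) * dist s t - (C + 1) \<le> ?d s t \<and> ?d s t \<le> (M + C) * dist s t + (C + 1)"
    if st: "s \<in> {0..real m}" "t \<in> {0..real m}" "s \<le> t" for s t
  proof -
    define k where "k = nat \<lfloor>t\<rfloor> - nat \<lfloor>s\<rfloor>"
    have le: "nat \<lfloor>s\<rfloor> \<le> nat \<lfloor>t\<rfloor>" using st by (intro nat_mono floor_mono) auto
    then have "real k = real (nat \<lfloor>t\<rfloor>) - real (nat \<lfloor>s\<rfloor>)" unfolding k_def by simp
    moreover have "real (nat \<lfloor>t\<rfloor>) = of_int \<lfloor>t\<rfloor>" "real (nat \<lfloor>s\<rfloor>) = of_int \<lfloor>s\<rfloor>" using st by auto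
    ultimately have k: "real k \<le> (t - s) + 1" "(t - s) - 1 \<le> real k" by linarith+
    have dist: "dist s t = t - s" using st by (simp add: dist_real_def)
    have "C * real k \<le> C * ((t - s) + 1)" using k assms(1) by (intro mult_left_mono) auto
    also have "\<dots> \<le> (M + C) * (t - s) + (C + 1)"
    proof -
      have "0 \<le> M * (t - s)" using assms(2) st by simp
      then show ?thesis unfolding distrib_right distrib_left by linarith
    qed
    finally have "?d s t \<le> (M + C) * dist s t + (C + 1)"
      using upper[OF le m[OF st(2)]] unfolding dist k_def by linarith
    moreover have "1 / (M + C) * (t - s) - (C + 1) \<le> real k / M"
    proof -
      have "1 / (M + C) * (t - s) \<le> 1 / M * (t - s)"
        using assms(1,2) st by (intro mult_right_mono divide_left_mono) auto
      also have "\<dots> \<le> 1 / M * (real k + 1)" using k assms(2) by (intro mult_left_mono) auto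
      also have "\<dots> \<le> real k / M + 1" using assms(2) by (simp add: add_divide_distrib)
      finally show ?thesis using assms(1) by linarith
    qed
    ultimately show ?thesis
      using lower[OF le m[OF st(2)]] unfolding dist k_def by linarith
  qed
  fix s t assume st: "s \<in> {0..real m}" "t \<in> {0..real m}"
  have "1 / (M + C) * dist s t - (C + 1) \<le> ?d s t \<and> ?d s t \<le> (M + C) * dist s t + (C + 1)"
  proof (cases "s \<le> t")
    case True
    then show ?thesis by (rule *[OF st])
  next
    case False
    then have "t \<le> s" by simp
    from *[OF st(2,1) this] show ?thesis
      by (simp only: dist_commute[of t s]
          cayley_dist_sym[of "racg \<Gamma>" A "cayley_vertex (P (nat \<lfloor>t\<rfloor>))" "cayley_vertex (P (nat \<lfloor>s\<rfloor>))"])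
  qed
  then show "1 / (M + C) * dist s t - (C + 1) \<le> ?d s t" "?d s t \<le> (M + C) * dist s t + (C + 1)"
    by (rule conjunct1, rule conjunct2)
qed simp

lemma chain_path:
  assumes P: "\<And>i. i \<le> m \<Longrightarrow> P i \<in> W"
    and step: "\<And>i. i < m \<Longrightarrow> \<exists>l\<le>C. cayley_path (racg \<Gamma>) A (cayley_vertex (P i)) l (cayley_vertex (P (Suc i)))"
    and "i \<le> j" "j \<le> m"
  shows "\<exists>l\<le>C * real (j - i). cayley_path (racg \<Gamma>) A (cayley_vertex (P i)) l (cayley_vertex (P j))"
  using assms(3,4)
proof (induction j rule: dec_induct)
  case base
  then show ?case using P by (intro exI[of _ 0]) (auto intro: cayley_path_vertex)
next
  case (step j)
  then obtain l l' where l: "l \<le> C * real (j - i)"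
      "cayley_path (racg \<Gamma>) A (cayley_vertex (P i)) l (cayley_vertex (P j))"
    and l': "l' \<le> C" "cayley_path (racg \<Gamma>) A (cayley_vertex (P j)) l' (cayley_vertex (P (Suc j)))"
    using assms(2)[of j] by auto
  have "real (Suc j - i) = real (j - i) + 1" using step by (simp add: Suc_diff_le)
  then have "l + l' \<le> C * real (Suc j - i)" using l l' by (simp add: algebra_simps)
  then show ?case using cayley_path_trans[OF l'(2) l(2)] by blast
qed

text \<open>The zigzag \<open>Q\<close> in \<open>s, t\<close> and the detour \<open>P\<close> are quasi-geodesics with constants independent of \<open>n\<close>:
  the upper bound \<open>C\<close> is the cost of one letter in the given generating set, the lower
  bound comes from the positions on the two lines, which are the two coordinates of the path. The top of the
  detour has distance at least \<open>n / M\<close> from \<open>Q\<close>, which exceeds any prescribed \<open>R\<close> for large \<open>n\<close>.\<close>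

lemma not_stable_special:
  assumes U: "U \<subseteq> S" "s \<in> U" "t \<in> U" and st: "s \<noteq> t" "\<not> adj s t" and uw: "u \<noteq> w" "\<not> adj u w"
    and sq: "adj s u" "adj s w" "adj t u" "adj t w"
  shows "\<not> stable_subgroup (racg \<Gamma>) (special U)"
proof
  assume "stable_subgroup (racg \<Gamma>) (special U)"
  then obtain A where A: "finite_generating_set (racg \<Gamma>) A"
    and stab: "\<And>K L. K \<ge> 1 \<Longrightarrow> L \<ge> 0 \<Longrightarrow> \<exists>R\<ge>0. \<forall>a b f a' b' f'.
      quasi_geodesic K L (cayley_points (racg \<Gamma>) A) (cayley_dist (racg \<Gamma>) A) a b f \<and>
      quasi_geodesic K L (cayley_points (racg \<Gamma>) A) (cayley_dist (racg \<Gamma>) A) a' b' f' \<and>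
      f a = f' a' \<and> f b = f' b' \<and> {f a, f b} \<subseteq> cayley_vertex ` special U \<longrightarrow>
      hausdorff_dist (cayley_dist (racg \<Gamma>) A) (f ` {a..b}) (f' ` {a'..b'}) < ereal R"
    unfolding stable_subgroup_def by metis
  let ?d = "cayley_dist (racg \<Gamma>) A"
  have AW: "finite A" "A \<subseteq> W" "generate (racg \<Gamma>) A = W" using A unfolding finite_generating_set_def by auto
  have S: "s \<in> S" "t \<in> S" "u \<in> S" "w \<in> S" using adj_verts sq by auto
  have ne: "{u, w} \<inter> {s, t} = {}" using sq adj_irrefl by auto
  have conn: "\<exists>l. cayley_path (racg \<Gamma>) A (cayley_vertex g) l (cayley_vertex h)" if "g \<in> W" "h \<in> W" for g h
    using G.cayley_connected[OF AW(2,3), of "cayley_vertex g" "cayley_vertex h"] that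
    by (auto simp: cayley_points_def)
  have "\<exists>C. \<forall>g\<in>W. \<exists>l\<le>C. cayley_path (racg \<Gamma>) A (cayley_vertex g) l (cayley_vertex (g \<cdot> \<sigma> c))" if "c \<in> S" for c
    using G.cayley_path_generate[OF AW(2), of "\<sigma> c"] AW(3) that by (metis gen_closed order_refl)
  then obtain cost where cost: "\<And>c g. c \<in> S \<Longrightarrow> g \<in> W \<Longrightarrow>
      \<exists>l\<le>cost c. cayley_path (racg \<Gamma>) A (cayley_vertex g) l (cayley_vertex (g \<cdot> \<sigma> c))" by metis
  define C where "C = (\<Sum>c\<in>S. \<bar>cost c\<bar>)"
  have "cost c \<le> C" if "c \<in> S" for c
    using member_le_sum[of c S "\<lambda>c. \<bar>cost c\<bar>"] that finite_S unfolding C_def by simp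
  then have step: "\<exists>l\<le>C. cayley_path (racg \<Gamma>) A (cayley_vertex g) l (cayley_vertex (g \<cdot> \<sigma> c))"
    if "c \<in> S" "g \<in> W" for c g
    using cost[OF that] that by (meson order_trans)
  have C0: "0 \<le> C" unfolding C_def by (intro sum_nonneg) simp
  define M :: real where "M = 1 + (\<Sum>a\<in>A. \<bar>line_position s t a\<bar> + \<bar>line_position u w a\<bar>)"
  have M1: "1 \<le> M" unfolding M_def by (simp add: sum_nonneg)
  have MA: "real_of_int \<bar>line_position s t a\<bar> \<le> M" "real_of_int \<bar>line_position u w a\<bar> \<le> M" if "a \<in> A" for a
  proof -
    have "\<bar>line_position s t a\<bar> + \<bar>line_position u w a\<bar> \<le>
        (\<Sum>a\<in>A. \<bar>line_position s t a\<bar> + \<bar>line_position u w a\<bar>)"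
      using that AW by (intro member_le_sum[of a A "\<lambda>a. \<bar>line_position s t a\<bar> + \<bar>line_position u w a\<bar>"]) auto
    then show "real_of_int \<bar>line_position s t a\<bar> \<le> M" "real_of_int \<bar>line_position u w a\<bar> \<le> M"
      unfolding M_def by linarith+
  qed
  have far: "\<bar>line_position x y g - line_position x y h\<bar> / M \<le> ?d (cayley_vertex g) (cayley_vertex h)"
    if xy: "x \<noteq> y" "\<not> adj x y" "\<And>a. a \<in> A \<Longrightarrow> real_of_int \<bar>line_position x y a\<bar> \<le> M" and gh: "g \<in> W" "h \<in> W"
    for x y g h
  proof -
    obtain l where l: "cayley_path (racg \<Gamma>) A (cayley_vertex g) l (cayley_vertex h)" using conn gh by blast
    have "\<bar>real_of_int (line_position x y p) - real_of_int (line_position x y q)\<bar> \<le> M"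
      if pq: "cayley_adj (racg \<Gamma>) A p q" for p q
    proof -
      obtain a where a: "p \<in> W" "q \<in> W" "a \<in> A" "q = p \<cdot> a \<or> p = q \<cdot> a"
        using pq unfolding cayley_adj_def by blast
      then have "a \<in> W" using AW(2) by blast
      then have "\<bar>line_position x y p - line_position x y q\<bar> = \<bar>line_position x y a\<bar>"
        using a(4) line_position_step[OF xy(1,2) a(1), of a] line_position_step[OF xy(1,2) a(2), of a]
        by (elim disjE) (simp_all add: abs_minus_commute)
      then show ?thesis using xy(3)[OF a(3)] by linarith
    qed
    from cayley_dist_lipschitz[OF l _ this] M1 show ?thesis by simp
  qed
  note far_st = far[OF st MA(1)] and far_uw = far[OF uw MA(2)]
  have "1 \<le> 3 * M + C" "0 \<le> C + 1" using M1 C0 by simp_all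
  from stab[OF this] obtain R where R: "\<forall>a b f a' b' f'.
      quasi_geodesic (3 * M + C) (C + 1) (cayley_points (racg \<Gamma>) A) ?d a b f \<and>
      quasi_geodesic (3 * M + C) (C + 1) (cayley_points (racg \<Gamma>) A) ?d a' b' f' \<and>
      f a = f' a' \<and> f b = f' b' \<and> {f a, f b} \<subseteq> cayley_vertex ` special U \<longrightarrow>
      hausdorff_dist ?d (f ` {a..b}) (f' ` {a'..b'}) < ereal R"
    by (elim exE conjE) (rule that)
  define n where "n = nat \<lceil>M * R\<rceil>"
  define P where "P i = zigzag u w (detour_up n i) \<cdot> zigzag s t (detour_along n i)" for i
  have PW: "P i \<in> W" for i unfolding P_def using S by simp
  have pos: "line_position u w (P i) = - int (detour_up n i)" "line_position s t (P i) = - int (detour_along n i)" for i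
    unfolding P_def line_position_def
    using S st uw ne line_action_zigzag[OF uw S(3,4)] line_action_zigzag[OF st S(1,2)]
      line_action_other_zigzag[OF uw S(1,2)] line_action_other_zigzag[OF st S(3,4)]
      racg_action_mult[OF line_reflections[OF uw]] racg_action_mult[OF line_reflections[OF st]]
    by (auto simp: Int_commute)
  have P_step: "\<exists>l\<le>C. cayley_path (racg \<Gamma>) A (cayley_vertex (P i)) l (cayley_vertex (P (Suc i)))"
    if "i < 3 * n" for i
    using detour_step[OF that]
  proof (elim disjE conjE)
    let ?c = "if even (detour_up n i) then u else w"
    assume "detour_up n (Suc i) = Suc (detour_up n i)" "detour_along n (Suc i) = 0" "detour_along n i = 0"
    then have "P (Suc i) = P i \<cdot> \<sigma> ?c" unfolding P_def using S by simp
    then show ?thesis using step[of ?c "P i"] PW S by simp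
  next
    let ?c = "if even (detour_along n i) then s else t"
    assume "detour_up n (Suc i) = detour_up n i" "detour_along n (Suc i) = Suc (detour_along n i)"
    then have "P (Suc i) = P i \<cdot> \<sigma> ?c" unfolding P_def using S by (simp add: G.m_assoc)
    then show ?thesis using step[of ?c "P i"] PW S by simp
  next
    let ?c = "if even (detour_up n (Suc i)) then u else w"
    assume up: "Suc (detour_up n (Suc i)) = detour_up n i" and along: "detour_along n (Suc i) = detour_along n i"
    have "\<sigma> ?c \<cdot> zigzag s t (detour_along n i) = zigzag s t (detour_along n i) \<cdot> \<sigma> ?c"
      using sq adj_sym by (intro zigzag_commute) auto
    then have "P i = P (Suc i) \<cdot> \<sigma> ?c" unfolding P_def up[symmetric] along using S by (simp add: G.m_assoc)
    then obtain l where "l \<le> C" "cayley_path (racg \<Gamma>) A (cayley_vertex (P (Suc i))) l (cayley_vertex (P i))"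
      using step[OF _ PW, of ?c "Suc i"] S by (auto split: if_splits)
    then show ?thesis using cayley_path_sym by blast
  qed
  have qP: "quasi_geodesic (3 * M + C) (C + 1) (cayley_points (racg \<Gamma>) A) ?d
      0 (real (3 * n)) (\<lambda>t. cayley_vertex (P (nat \<lfloor>t\<rfloor>)))"
  proof (rule quasi_geodesic_of_sequence[OF C0])
    fix i j assume ij: "i \<le> j" "j \<le> 3 * n"
    show "?d (cayley_vertex (P i)) (cayley_vertex (P j)) \<le> C * real (j - i)"
      using chain_path[where P = P, OF PW P_step ij] by (auto intro: order_trans[OF cayley_dist_le])
    have "\<bar>real (detour_up n j) - real (detour_up n i)\<bar> / M \<le> ?d (cayley_vertex (P i)) (cayley_vertex (P j))"
      "\<bar>real (detour_along n j) - real (detour_along n i)\<bar> / M \<le> ?d (cayley_vertex (P i)) (cayley_vertex (P j))"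
      using far_uw[OF _ PW PW, of i j] far_st[OF _ PW PW, of i j] by (simp_all add: pos)
    then show "real (j - i) / (3 * M) \<le> ?d (cayley_vertex (P i)) (cayley_vertex (P j))"
      using detour_spread[OF ij] M1 by (auto simp: field_simps)
  qed (use PW M1 in auto)
  define Q where "Q = zigzag s t"
  have QW: "Q i \<in> W" for i unfolding Q_def using S by simp
  have posQ: "line_position s t (Q i) = - int i" "line_position u w (Q i) = 0" for i
    unfolding Q_def line_position_def
    using line_action_zigzag[OF st S(1,2)] line_action_other_zigzag[OF uw S(1,2)] ne by (auto simp: Int_commute)
  have Q_step: "\<exists>l\<le>C. cayley_path (racg \<Gamma>) A (cayley_vertex (Q i)) l (cayley_vertex (Q (Suc i)))" for i
    using step[of "if even i then s else t" "Q i"] QW S unfolding Q_def by simp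
  have qQ: "quasi_geodesic (3 * M + C) (C + 1) (cayley_points (racg \<Gamma>) A) ?d
      0 (real n) (\<lambda>t. cayley_vertex (Q (nat \<lfloor>t\<rfloor>)))"
  proof (rule quasi_geodesic_of_sequence[OF C0])
    fix i j assume ij: "i \<le> j" "j \<le> n"
    show "?d (cayley_vertex (Q i)) (cayley_vertex (Q j)) \<le> C * real (j - i)"
      using chain_path[where P = Q, OF QW Q_step ij] by (auto intro: order_trans[OF cayley_dist_le])
    have "real (j - i) / (3 * M) \<le> real (j - i) / M" using M1 by (intro divide_left_mono) auto
    also have "real (j - i) / M \<le> ?d (cayley_vertex (Q i)) (cayley_vertex (Q j))"
      using far_st[OF _ QW QW, of i j] ij unfolding posQ by (simp add: of_nat_diff)
    finally show "real (j - i) / (3 * M) \<le> ?d (cayley_vertex (Q i)) (cayley_vertex (Q j))" .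
  qed (use QW M1 in auto)
  have ends: "P 0 = e" "P (3 * n) = Q n" "Q 0 = e"
    unfolding P_def Q_def detour_up_def detour_along_def using S by auto
  have UQ: "Q i \<in> special U" for i unfolding Q_def using zigzag_special U by auto
  have "\<lfloor>3 * real n\<rfloor> = int (3 * n)" by linarith
  then have floor: "nat \<lfloor>3 * real n\<rfloor> = 3 * n" by simp
  have "e \<in> special U" by (rule generate.one)
  then have "hausdorff_dist ?d ((\<lambda>t. cayley_vertex (P (nat \<lfloor>t\<rfloor>))) ` {0..real (3 * n)})
      ((\<lambda>t. cayley_vertex (Q (nat \<lfloor>t\<rfloor>))) ` {0..real n}) < ereal R"
    using UQ ends qP qQ floor by (intro R[rule_format]) auto
  then obtain \<epsilon> where "\<epsilon> < R" and
    \<epsilon>: "\<forall>p\<in>(\<lambda>t. cayley_vertex (P (nat \<lfloor>t\<rfloor>))) ` {0..real (3 * n)}.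
      \<exists>q\<in>(\<lambda>t. cayley_vertex (Q (nat \<lfloor>t\<rfloor>))) ` {0..real n}. ?d p q \<le> \<epsilon>"
    unfolding hausdorff_dist_def Inf_less_iff by auto
  have "cayley_vertex (P n) \<in> (\<lambda>t. cayley_vertex (P (nat \<lfloor>t\<rfloor>))) ` {0..real (3 * n)}"
    by (intro image_eqI[of _ _ "real n"]) auto
  then obtain j where j: "?d (cayley_vertex (P n)) (cayley_vertex (Q j)) \<le> \<epsilon>" using \<epsilon> by auto
  have "real n / M \<le> ?d (cayley_vertex (P n)) (cayley_vertex (Q j))"
    using far_uw[OF _ PW QW, of n j] unfolding pos posQ by (simp add: detour_up_def)
  then have "real n / M < R" using j \<open>\<epsilon> < R\<close> by linarith
  then have "real n < M * R" using M1 by (simp add: field_simps)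
  moreover have "M * R \<le> real n" unfolding n_def by linarith
  ultimately show False by simp
qed

end

section \<open>The characterisation of stability\<close>

theorem corollary1p12:
  fixes \<Gamma> :: "'a pair_pre_digraph" and S\<^sub>1 :: "'a set"
  assumes "pair_graph \<Gamma>"
    and "triangle_free \<Gamma>"
    and "S\<^sub>1 \<subseteq> pverts \<Gamma>"
  shows "stable_subgroup (racg \<Gamma>) (generate (racg \<Gamma>) (racg_gen \<Gamma> ` S\<^sub>1)) \<longleftrightarrow>
    \<not> (\<exists>a b c d x y. induced_four_cycle \<Gamma> a b c d \<and> {x, y} \<subseteq> {a, b, c, d} \<inter> S\<^sub>1 \<and>
        x \<noteq> y \<and> (x, y) \<notin> parcs \<Gamma>)"
proof -
  interpret coxeter_graph \<Gamma> by (rule coxeter_graph.intro[OF assms(1)])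
  show ?thesis
  proof
    assume stable: "stable_subgroup (racg \<Gamma>) (special S\<^sub>1)"
    show "\<not> (\<exists>a b c d x y. induced_four_cycle \<Gamma> a b c d \<and> {x, y} \<subseteq> {a, b, c, d} \<inter> S\<^sub>1 \<and>
        x \<noteq> y \<and> (x, y) \<notin> parcs \<Gamma>)"
    proof clarify
      fix a b c d x y
      assume cycle: "induced_four_cycle \<Gamma> a b c d"
        and xy: "{x, y} \<subseteq> {a, b, c, d} \<inter> S\<^sub>1" "x \<noteq> y" "\<not> adj x y"
      have arcs: "adj a b" "adj b c" "adj c d" "adj d a" "\<not> adj a c" "\<not> adj b d" "a \<noteq> c" "b \<noteq> d"
        using cycle unfolding induced_four_cycle_def by auto
      note arcs' = arcs(1-4)[THEN adj_sym]
      have "{x, y} = {a, c} \<or> {x, y} = {b, d}"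
        using xy arcs(1-4) arcs' by auto
      then show False
      proof
        assume "{x, y} = {a, c}"
        then have "a \<in> S\<^sub>1" "c \<in> S\<^sub>1" using xy by auto
        then show False
          using not_stable_special[OF assms(3) _ _ arcs(7,5,8,6)] arcs arcs' stable by blast
      next
        assume "{x, y} = {b, d}"
        then have "b \<in> S\<^sub>1" "d \<in> S\<^sub>1" using xy by auto
        then show False
          using not_stable_special[OF assms(3) _ _ arcs(8,6,7,5)] arcs arcs' stable by blast
      qed
    qed
  next
    assume no_cycle: "\<not> (\<exists>a b c d x y. induced_four_cycle \<Gamma> a b c d \<and>
        {x, y} \<subseteq> {a, b, c, d} \<inter> S\<^sub>1 \<and> x \<noteq> y \<and> (x, y) \<notin> parcs \<Gamma>)"
    have "thin_links S\<^sub>1"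
      unfolding thin_links_def
    proof (intro ballI allI impI, rule ccontr)
      fix s t u v
      assume st: "s \<in> S\<^sub>1" "t \<in> S\<^sub>1" "s \<noteq> t" "\<not> adj s t"
        and adj: "adj s u" "adj t u" "adj s v" "adj t v" and "u \<noteq> v"
      have "\<not> adj u v"
        using assms(2) adj adj_sym unfolding triangle_free_def by blast
      moreover have "s \<noteq> u" "s \<noteq> v" "t \<noteq> u" "t \<noteq> v" using adj adj_irrefl by auto
      ultimately have "induced_four_cycle \<Gamma> s u t v"
        unfolding induced_four_cycle_def
        using st adj \<open>u \<noteq> v\<close> adj_sym[OF adj(2)] adj_sym[OF adj(3)] adj_verts by auto
      then show False using no_cycle st by blast
    qed
    then show "stable_subgroup (racg \<Gamma>) (special S\<^sub>1)"
      by (rule stable_special[OF assms(2,3)])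
  qed
qed

end
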